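(* Let $a_0\ge0$, $b_0\in\mathbb R$ and $t_0\in[0,2\pi)$, with $(a_0,b_0)\neq(0,0)$. If $a_0>0$, let $\mathcal W=\{p\in\mathcal C: a(p)=a_0,\ b(p)=b_0,\ t(p)=t_0\}$; if $a_0=0$ (in which case $t$ is undefined), let $\mathcal W=\{p\in\mathcal C:a(p)=0,\ b(p)=b_0\}$. Then $\mathcal W$ is a coassociative submanifold of $\mathcal C$ (with respect to $\varphi$) diffeomorphic to the tangent bundle $TS^2$.
   Context: Let $x_0,\dots,x_7$ be the standard coordinates on $\mathbb R^8$, with partial derivatives $\partial_i$, $e=\sum_idx_i\otimes dx_i$, $R=\sum_ix_i^2$, and complex coordinates $z_0=x_0+ix_1$, $z_1=x_2-ix_3$, $z_2=x_4+ix_5$, $z_3=x_6-ix_7$. Put $Y_1=-x_1\partial_0+x_0\partial_1+x_3\partial_2-x_2\partial_3-x_5\partial_4+x_4\partial_5+x_7\partial_6-x_6\partial_7$, $Y_2=-x_2\partial_0+x_0\partial_2+x_1\partial_3-x_3\partial_1-x_6\partial_4+x_4\partial_6+x_5\partial_7-x_7\partial_5$, $Y_3=-x_3\partial_0+x_0\partial_3+x_2\partial_1-x_1\partial_2-x_7\partial_4+x_4\partial_7+x_6\partial_5-x_5\partial_6$, $\alpha_i=e(Y_i,\cdot)$, $\hat\alpha_i=\alpha_i/R$. The flow of $Y_1$ (which is $z_i\mapsto e^{i\tau}z_i$) is a free circle action on $\mathbb R^8\setminus0$ with quotient $\mathcal C=\mathbb R^+\times\mathbb{CP}^3$; tensors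 on $\mathcal C$ are identified with their pullbacks to $\mathbb R^8\setminus0$. The conical torsion-free $G_2$ structure on $\mathcal C$ has 3-form $\varphi=d(\tfrac13R^3\omega)$ with $\omega=d\hat\alpha_1+3\hat\alpha_2\wedge\hat\alpha_3$, and metric $h_2=\tfrac12dR^2+2R\,e-2\alpha_1^2-\alpha_2^2-\alpha_3^2$. A coassociative submanifold is a 4-dimensional submanifold on which $\varphi$ pulls back to zero. Let $f_+=z_0\bar z_3-\bar z_1z_2$, $u=|z_0|^2+|z_2|^2$, $v=|z_1|^2+|z_3|^2$ (so $R=u+v$); these are well defined on $\mathcal C$. Set $a=2|f_+|^2$, $b=u^2-v^2=R(u-v)$, and, where $f_+\ne0$, $t=\arg f_+\in[0,2\pi)$. (With $s\in[0,1]$ defined by $1-s^2=2a/R^2$, the condition $s<1$ is equivalent to $a>0$.) *)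

theory Defs
  imports "HOL-Analysis.Analysis"
begin

section \<open>Smooth maps and tangent vectors in Euclidean spaces\<close>

text \<open>\<open>Ck_on k S f\<close> is meant for open \<open>S\<close>: all iterated directional derivatives of order up to
  \<open>k\<close> exist and are continuous on \<open>S\<close>.\<close>

primrec Ck_on ::
  "nat \<Rightarrow> 'a::euclidean_space set \<Rightarrow> ('a \<Rightarrow> 'b::euclidean_space) \<Rightarrow> bool" where
  "Ck_on 0 S f \<longleftrightarrow> continuous_on S f"
| "Ck_on (Suc k) S f \<longleftrightarrow>
     (\<forall>x\<in>S. f differentiable (at x)) \<and>
     (\<forall>v. Ck_on k S (\<lambda>x. frechet_derivative f (at x) v))"

definition smooth_on :: "'a::euclidean_space set \<Rightarrow> ('a \<Rightarrow> 'b::euclidean_space) \<Rightarrow> bool" where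
  "smooth_on S f \<longleftrightarrow> (\<forall>k. Ck_on k S f)"

text \<open>Velocities at \<open>x\<close> of smooth curves running inside \<open>S\<close>; for an embedded submanifold \<open>S\<close> of
  a Euclidean space this is its tangent space at \<open>x\<close>.\<close>

definition tangent_space :: "'a::euclidean_space set \<Rightarrow> 'a \<Rightarrow> 'a set" where
  "tangent_space S x =
     {v. \<exists>\<epsilon>>0. \<exists>c :: real \<Rightarrow> 'a. smooth_on {-\<epsilon><..<\<epsilon>} c \<and> c ` {-\<epsilon><..<\<epsilon>} \<subseteq> S \<and>
           c 0 = x \<and> (c has_vector_derivative v) (at 0)}"

definition tangent_bundle :: "'a::euclidean_space set \<Rightarrow> ('a \<times> 'a) set" where
  "tangent_bundle S = {(p, v). p \<in> S \<and> v \<in> tangent_space S p}"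

section \<open>Charts, embedded submanifolds, diffeomorphisms\<close>

text \<open>A smooth structure is given by its set of charts; a chart is a domain together with a
  map that is only relevant on that domain.\<close>

type_synonym ('p, 'e) chart = "'p set \<times> ('p \<Rightarrow> 'e)"

definition smooth_map ::
  "'p set \<Rightarrow> ('p, 'd::euclidean_space) chart set \<Rightarrow> ('q, 'e::euclidean_space) chart set
     \<Rightarrow> ('p \<Rightarrow> 'q) \<Rightarrow> bool" where
  "smooth_map M A B F \<longleftrightarrow>
     (\<forall>p\<in>M. \<exists>(U, \<phi>)\<in>A. \<exists>(V, \<psi>)\<in>B.
        p \<in> U \<and> F ` U \<subseteq> V \<and> smooth_on (\<phi> ` U) (\<psi> \<circ> F \<circ> inv_into U \<phi>))"

definition diffeomorphic ::
  "'p set \<Rightarrow> ('p, 'd::euclidean_space) chart set \<Rightarrow>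
   'q set \<Rightarrow> ('q, 'e::euclidean_space) chart set \<Rightarrow> bool" where
  "diffeomorphic M A N B \<longleftrightarrow>
     (\<exists>F. bij_betw F M N \<and> smooth_map M A B F \<and> smooth_map N B A (inv_into M F))"

text \<open>Charts of the ambient manifold take values in a product \<open>'k \<times> 'c\<close>, where \<open>DIM('k)\<close> is the
  dimension and \<open>DIM('c)\<close> the codimension of the submanifold \<open>W\<close>. A slice chart maps \<open>W\<close> to the
  slice \<open>'k \<times> {0}\<close>, and its first component is then a chart of \<open>W\<close>.\<close>

definition submanifold_charts ::
  "('p, 'k::euclidean_space \<times> 'c::euclidean_space) chart set \<Rightarrow> 'p set \<Rightarrow> ('p, 'k) chart set" where
  "submanifold_charts A W =
     {(U \<inter> W, fst \<circ> \<phi>) | U \<phi>. (U, \<phi>) \<in> A \<and> \<phi> ` (U \<inter> W) = {y \<in> \<phi> ` U. snd y = 0}}"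

definition embedded_submanifold ::
  "('p, 'k::euclidean_space \<times> 'c::euclidean_space) chart set \<Rightarrow> 'p set \<Rightarrow> bool" where
  "embedded_submanifold A W \<longleftrightarrow> (\<Union>(U, \<phi>)\<in>submanifold_charts A W. U) = W"

text \<open>The maximal atlas of the standard smooth structure of a Euclidean space.\<close>

definition euclidean_charts :: "('a::euclidean_space, 'e::euclidean_space) chart set" where
  "euclidean_charts =
     {(U, \<phi>). open U \<and> smooth_on U \<phi> \<and> inj_on \<phi> U \<and>
              open (\<phi> ` U) \<and> smooth_on (\<phi> ` U) (inv_into U \<phi>)}"

section \<open>Differential forms\<close>

type_synonym 'a one_form = "'a \<Rightarrow> 'a \<Rightarrow> real"
type_synonym 'a two_form = "'a \<Rightarrow> 'a \<Rightarrow> 'a \<Rightarrow> real"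
type_synonym 'a three_form = "'a \<Rightarrow> 'a \<Rightarrow> 'a \<Rightarrow> 'a \<Rightarrow> real"

text \<open>The first argument of a form is the base point. The exterior derivatives are the invariant
  formulas evaluated on constant vector fields, whose Lie brackets vanish.\<close>

definition wedge :: "'a one_form \<Rightarrow> 'a one_form \<Rightarrow> 'a two_form" where
  "wedge \<alpha> \<beta> x X Y = \<alpha> x X * \<beta> x Y - \<alpha> x Y * \<beta> x X"

definition ext_deriv1 :: "'a::euclidean_space one_form \<Rightarrow> 'a two_form" where
  "ext_deriv1 \<alpha> x X Y =
     frechet_derivative (\<lambda>y. \<alpha> y Y) (at x) X - frechet_derivative (\<lambda>y. \<alpha> y X) (at x) Y"

definition ext_deriv2 :: "'a::euclidean_space two_form \<Rightarrow> 'a three_form" where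
  "ext_deriv2 \<beta> x X Y Z =
     frechet_derivative (\<lambda>y. \<beta> y Y Z) (at x) X
     - frechet_derivative (\<lambda>y. \<beta> y X Z) (at x) Y
     + frechet_derivative (\<lambda>y. \<beta> y X Y) (at x) Z"

section \<open>The cone over complex projective 3-space\<close>

text \<open>The coordinates are \<open>x $ 0, \<dots>, x $ 7\<close>, indexed by the type \<open>8\<close> of residues modulo 8.\<close>

abbreviation pd :: "8 \<Rightarrow> real^8" where
  "pd i \<equiv> axis i 1"

definition Y1 :: "real^8 \<Rightarrow> real^8" where
  "Y1 x = - (x$1) *\<^sub>R pd 0 + (x$0) *\<^sub>R pd 1 + (x$3) *\<^sub>R pd 2 - (x$2) *\<^sub>R pd 3
          - (x$5) *\<^sub>R pd 4 + (x$4) *\<^sub>R pd 5 + (x$7) *\<^sub>R pd 6 - (x$6) *\<^sub>R pd 7"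

definition Y2 :: "real^8 \<Rightarrow> real^8" where
  "Y2 x = - (x$2) *\<^sub>R pd 0 + (x$0) *\<^sub>R pd 2 + (x$1) *\<^sub>R pd 3 - (x$3) *\<^sub>R pd 1
          - (x$6) *\<^sub>R pd 4 + (x$4) *\<^sub>R pd 6 + (x$5) *\<^sub>R pd 7 - (x$7) *\<^sub>R pd 5"

definition Y3 :: "real^8 \<Rightarrow> real^8" where
  "Y3 x = - (x$3) *\<^sub>R pd 0 + (x$0) *\<^sub>R pd 3 + (x$2) *\<^sub>R pd 1 - (x$1) *\<^sub>R pd 2
          - (x$7) *\<^sub>R pd 4 + (x$4) *\<^sub>R pd 7 + (x$6) *\<^sub>R pd 5 - (x$5) *\<^sub>R pd 6"

definition z0 :: "real^8 \<Rightarrow> complex" where "z0 x = Complex (x$0) (x$1)"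
definition z1 :: "real^8 \<Rightarrow> complex" where "z1 x = Complex (x$2) (- (x$3))"
definition z2 :: "real^8 \<Rightarrow> complex" where "z2 x = Complex (x$4) (x$5)"
definition z3 :: "real^8 \<Rightarrow> complex" where "z3 x = Complex (x$6) (- (x$7))"

text \<open>The flow of \<open>Y1\<close>; see the lemmas \<open>flow_has_vector_derivative\<close> and \<open>z_flow\<close>.\<close>

definition flow :: "real \<Rightarrow> real^8 \<Rightarrow> real^8" where
  "flow \<tau> x = cos \<tau> *\<^sub>R x + sin \<tau> *\<^sub>R Y1 x"

lemma UNIV_8: "(UNIV :: 8 set) = {0, 1, 2, 3, 4, 5, 6, 7}"
proof -
  have "card {0, 1, 2, 3, 4, 5, 6, 7 :: 8} = CARD(8)"
    by simp
  then show ?thesis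
    by (metis card_subset_eq finite subset_UNIV)
qed

lemma forall_8: "(\<forall>i::8. P i) \<longleftrightarrow> P 0 \<and> P 1 \<and> P 2 \<and> P 3 \<and> P 4 \<and> P 5 \<and> P 6 \<and> P 7"
proof -
  have "(\<forall>i::8. P i) \<longleftrightarrow> (\<forall>i\<in>UNIV. P i)"
    by simp
  also have "\<dots> \<longleftrightarrow> P 0 \<and> P 1 \<and> P 2 \<and> P 3 \<and> P 4 \<and> P 5 \<and> P 6 \<and> P 7"
    unfolding UNIV_8 by simp
  finally show ?thesis .
qed

lemma Y1_nth:
  "Y1 x $ 0 = - (x$1)" "Y1 x $ 1 = x$0" "Y1 x $ 2 = x$3" "Y1 x $ 3 = - (x$2)"
  "Y1 x $ 4 = - (x$5)" "Y1 x $ 5 = x$4" "Y1 x $ 6 = x$7" "Y1 x $ 7 = - (x$6)"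
  by (simp_all add: Y1_def axis_def)

lemma flow_0: "flow 0 x = x"
  by (simp add: flow_def)

lemma flow_has_vector_derivative:
  "((\<lambda>\<tau>. flow \<tau> x) has_vector_derivative Y1 (flow \<tau> x)) (at \<tau>)"
proof -
  have "((\<lambda>\<tau>. flow \<tau> x) has_vector_derivative (- sin \<tau>) *\<^sub>R x + cos \<tau> *\<^sub>R Y1 x) (at \<tau>)"
    unfolding flow_def by (auto intro!: derivative_eq_intros)
  moreover have "(- sin \<tau>) *\<^sub>R x + cos \<tau> *\<^sub>R Y1 x = Y1 (flow \<tau> x)"
    by (simp add: vec_eq_iff forall_8 Y1_nth flow_def)
  ultimately show ?thesis
    by simp
qed

lemma z_flow:
  "z0 (flow \<tau> x) = cis \<tau> * z0 x" "z1 (flow \<tau> x) = cis \<tau> * z1 x"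
  "z2 (flow \<tau> x) = cis \<tau> * z2 x" "z3 (flow \<tau> x) = cis \<tau> * z3 x"
  by (simp_all add: complex_eq_iff z0_def z1_def z2_def z3_def flow_def Y1_nth)

text \<open>A point of the quotient is an orbit, \<open>proj\<close> is the quotient map.\<close>

definition proj :: "real^8 \<Rightarrow> (real^8) set" where
  "proj x = range (\<lambda>\<tau>. flow \<tau> x)"

definition cone :: "(real^8) set set" where
  "cone = proj ` (- {0})"

definition preim :: "(real^8) set set \<Rightarrow> (real^8) set" where
  "preim U = {x. x \<noteq> 0 \<and> proj x \<in> U}"

text \<open>The maximal atlas of the quotient smooth structure, i.e. of the unique one for which \<open>proj\<close>
  is a smooth submersion. Openness of \<open>preim U\<close> is openness of \<open>U\<close> in the quotient topology. A map
  \<open>\<phi>\<close> on \<open>U\<close> is smooth, respectively a submersion, iff its pullback \<open>\<phi> \<circ> proj\<close> is; an injective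
  submersion is a diffeomorphism onto an open set.\<close>

definition cone_charts :: "((real^8) set, 'e::euclidean_space) chart set" where
  "cone_charts =
     {(U, \<phi>). U \<subseteq> cone \<and> open (preim U) \<and> inj_on \<phi> U \<and> smooth_on (preim U) (\<phi> \<circ> proj) \<and>
              (\<forall>x\<in>preim U. surj (frechet_derivative (\<phi> \<circ> proj) (at x)))}"

definition Rsq :: "real^8 \<Rightarrow> real" where
  "Rsq x = (\<Sum>i\<in>UNIV. (x$i)\<^sup>2)"

definition e_metric :: "real^8 \<Rightarrow> real^8 \<Rightarrow> real^8 \<Rightarrow> real" where
  "e_metric x X Y = (\<Sum>i\<in>UNIV. X$i * Y$i)"

definition alpha_hat :: "(real^8 \<Rightarrow> real^8) \<Rightarrow> (real^8) one_form" where
  "alpha_hat Y x X = e_metric x (Y x) X / Rsq x"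

definition omega :: "(real^8) two_form" where
  "omega x X Y =
     ext_deriv1 (alpha_hat Y1) x X Y + 3 * wedge (alpha_hat Y2) (alpha_hat Y3) x X Y"

definition varphi :: "(real^8) three_form" where
  "varphi = ext_deriv2 (\<lambda>x X Y. 1/3 * (Rsq x)^3 * omega x X Y)"

text \<open>Forms on the cone are identified with their pullbacks along \<open>proj\<close>. As \<open>preim W \<rightarrow> W\<close> is a
  surjective submersion, the restriction of the form to \<open>W\<close> is identified with the restriction of
  \<open>varphi\<close> to \<open>preim W\<close>.\<close>

definition varphi_vanishes_on :: "(real^8) set set \<Rightarrow> bool" where
  "varphi_vanishes_on W \<longleftrightarrow>
     (\<forall>x\<in>preim W. \<forall>X\<in>tangent_space (preim W) x. \<forall>Y\<in>tangent_space (preim W) x.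
        \<forall>Z\<in>tangent_space (preim W) x. varphi x X Y Z = 0)"

definition coassociative :: "(real^8) set set \<Rightarrow> bool" where
  "coassociative W \<longleftrightarrow>
     embedded_submanifold (cone_charts :: (_, (real^4) \<times> (real^3)) chart set) W \<and>
     varphi_vanishes_on W"

definition f_plus :: "real^8 \<Rightarrow> complex" where
  "f_plus x = z0 x * cnj (z3 x) - cnj (z1 x) * z2 x"

definition u_fun :: "real^8 \<Rightarrow> real" where "u_fun x = (cmod (z0 x))\<^sup>2 + (cmod (z2 x))\<^sup>2"
definition v_fun :: "real^8 \<Rightarrow> real" where "v_fun x = (cmod (z1 x))\<^sup>2 + (cmod (z3 x))\<^sup>2"
definition a_fun :: "real^8 \<Rightarrow> real" where "a_fun x = 2 * (cmod (f_plus x))\<^sup>2"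
definition b_fun :: "real^8 \<Rightarrow> real" where "b_fun x = (u_fun x)\<^sup>2 - (v_fun x)\<^sup>2"
definition t_fun :: "real^8 \<Rightarrow> real" where "t_fun x = Arg2pi (f_plus x)"

lemma f_plus_flow: "f_plus (flow \<tau> x) = f_plus x"
proof -
  have "cis \<tau> * cnj (cis \<tau>) = 1"
    by (simp add: cis_cnj cis_mult)
  then show ?thesis
    unfolding f_plus_def z_flow complex_cnj_mult
    by (metis (no_types, lifting) mult.assoc mult.left_commute mult_1)
qed

lemma u_v_flow: "u_fun (flow \<tau> x) = u_fun x" "v_fun (flow \<tau> x) = v_fun x"
  by (simp_all add: u_fun_def v_fun_def z_flow norm_mult)

text \<open>By the two preceding lemmas \<open>a_fun\<close>, \<open>b_fun\<close>, \<open>t_fun\<close> are constant on orbits, so their level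
  sets in the cone are the images of their level sets in the punctured space.\<close>

definition W_set :: "real \<Rightarrow> real \<Rightarrow> real \<Rightarrow> (real^8) set set" where
  "W_set a\<^sub>0 b\<^sub>0 t\<^sub>0 =
     (if a\<^sub>0 > 0 then {proj x | x. x \<noteq> 0 \<and> a_fun x = a\<^sub>0 \<and> b_fun x = b\<^sub>0 \<and> t_fun x = t\<^sub>0}
      else {proj x | x. x \<noteq> 0 \<and> a_fun x = 0 \<and> b_fun x = b\<^sub>0})"

definition W_charts :: "(real^8) set set \<Rightarrow> ((real^8) set, real^4) chart set" where
  "W_charts W = submanifold_charts (cone_charts :: (_, (real^4) \<times> (real^3)) chart set) W"

text \<open>The tangent bundle of the unit 2-sphere, as an embedded submanifold of 6-space.\<close>

definition TS2 :: "((real^3) \<times> (real^3)) set" where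
  "TS2 = tangent_bundle (sphere 0 1)"

definition TS2_charts :: "((real^3) \<times> (real^3), real^4) chart set" where
  "TS2_charts = submanifold_charts (euclidean_charts :: (_, (real^4) \<times> (real^2)) chart set) TS2"

end

theory Submission
  imports Defs
begin

text \<open>Write \<open>w = (z\<^sub>0, z\<^sub>2)\<close> and \<open>w' = (z\<^sub>3, -z\<^sub>1)\<close>, so that \<open>f = \<langle>w, w'\<rangle>\<close>, and put
  \<open>D = cnj (det (w, w'))\<close>. Lagrange's identity \<open>u v = |f|\<^sup>2 + |D|\<^sup>2\<close> together with \<open>u\<^sup>2 - v\<^sup>2 = b\<close>
  makes \<open>u\<close> a smooth function of \<open>f\<close>, \<open>b\<close>, \<open>|D|\<close>. Hence, where \<open>w \<noteq> 0\<close>, the orbit of \<open>(w, w')\<close> is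
  determined by \<open>f\<close>, \<open>b\<close>, the line spanned by \<open>w\<close>, which is a point of the sphere, and the tangent
  vector of the sphere at that point corresponding to \<open>D\<close>; so \<open>f\<close> and \<open>b\<close> are slice functions and
  their level sets are copies of the tangent bundle. If \<open>b \<ge> 0\<close> and \<open>(f, b) \<noteq> 0\<close> then \<open>w \<noteq> 0\<close>
  on the level set; for \<open>b < 0\<close> exchange \<open>w\<close> and \<open>w'\<close>.

  Off the origin \<open>\<phi> = R dR \<and> d\<alpha>\<^sub>1 + dR \<and> \<alpha>\<^sub>2 \<and> \<alpha>\<^sub>3 + R (d\<alpha>\<^sub>2 \<and> \<alpha>\<^sub>3 - \<alpha>\<^sub>2 \<and> d\<alpha>\<^sub>3)\<close>. It is expressed by
  the Hermitian form and the holomorphic symplectic form of \<open>\<complex>\<^sup>4\<close>, so the vanishing on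
  \<open>ker df \<inter> ker db\<close> only has to be checked at the points with \<open>w = (1, 0)\<close> and \<open>w'\<close> real.\<close>

section \<open>Calculus of smooth maps\<close>

lemma Ck_on_Suc_imp_Ck_on: "Ck_on (Suc k) S f \<Longrightarrow> Ck_on k S f"
proof (induction k arbitrary: f)
  case 0
  then show ?case
    by (auto intro!: continuous_at_imp_continuous_on differentiable_imp_continuous_within)
next
  case (Suc k)
  have "Ck_on (Suc k) S (\<lambda>x. frechet_derivative f (at x) v)" for v
    using Suc.prems by (subst (asm) Ck_on.simps(2)) blast
  then show ?case
    using Suc.prems Suc.IH by (subst Ck_on.simps(2)) simp
qed

lemma Ck_on_cong:
  assumes "open S" "\<And>x. x \<in> S \<Longrightarrow> f x = g x"
  shows "Ck_on k S f \<longleftrightarrow> Ck_on k S g"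
  using assms(2)
proof (induction k arbitrary: f g)
  case 0
  then show ?case
    by (simp cong: continuous_on_cong)
next
  case (Suc k)
  have d: "(f has_derivative f') (at x) \<longleftrightarrow> (g has_derivative f') (at x)" if "x \<in> S" for x f'
    using has_derivative_transform_within_open[OF _ assms(1) that] Suc.prems by metis
  then have "f differentiable (at x) \<longleftrightarrow> g differentiable (at x)"
    "frechet_derivative f (at x) = frechet_derivative g (at x)" if "x \<in> S" for x
    using that by (auto simp: differentiable_def frechet_derivative_def)
  then show ?case
    using Suc.IH[of "\<lambda>x. frechet_derivative f (at x) v" "\<lambda>x. frechet_derivative g (at x) v" for v]
    by simp
qed

text \<open>Derivatives are unique, so an explicit formula may replace
  \<open>frechet_derivative\<close>; the closure rules below go through this rule.\<close>

lemma Ck_on_SucI: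
  assumes "open S" "\<And>x. x \<in> S \<Longrightarrow> (f has_derivative f' x) (at x)" "\<And>v. Ck_on k S (\<lambda>x. f' x v)"
  shows "Ck_on (Suc k) S f"
proof -
  have "frechet_derivative f (at x) = f' x" if "x \<in> S" for x
    using assms(2)[OF that] by (metis frechet_derivative_at)
  then have "Ck_on k S (\<lambda>x. frechet_derivative f (at x) v)" for v
    using assms(3)[of v] by (subst Ck_on_cong[OF assms(1), of _ "\<lambda>x. f' x v"]) auto
  then show ?thesis
    using assms(2) by (auto simp: differentiable_def)
qed

lemma Ck_on_SucD:
  assumes "Ck_on (Suc k) S f"
  shows "x \<in> S \<Longrightarrow> (f has_derivative frechet_derivative f (at x)) (at x)"
    "Ck_on k S (\<lambda>x. frechet_derivative f (at x) v)" "Ck_on k S f"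
  using assms Ck_on_Suc_imp_Ck_on[OF assms] by (auto simp: frechet_derivative_works)

lemma Ck_on_const: "open S \<Longrightarrow> Ck_on k S (\<lambda>x. c)"
proof (induction k arbitrary: c)
  case (Suc k)
  then show ?case
    by (intro Ck_on_SucI[where f' = "\<lambda>x v. 0"]) auto
qed simp

lemma Ck_on_bounded_linear:
  assumes "bounded_linear h" "open S" "Ck_on k S f"
  shows "Ck_on k S (\<lambda>x. h (f x))"
  using assms(3)
proof (induction k arbitrary: f)
  case 0
  then show ?case
    using bounded_linear.continuous_on[OF assms(1)] by simp
next
  case (Suc k)
  show ?case
    using Ck_on_SucD[OF Suc.prems] assms(2) Suc.IH
    by (intro Ck_on_SucI[where f' = "\<lambda>x v. h (frechet_derivative f (at x) v)"]
          bounded_linear.has_derivative[OF assms(1)]) auto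
qed

lemma Ck_on_id: "open S \<Longrightarrow> Ck_on k S (\<lambda>x. x)"
  by (cases k) (auto intro!: Ck_on_SucI[where f' = "\<lambda>x v. v"] Ck_on_const simp del: Ck_on.simps(2))

lemma Ck_on_add:
  assumes "open S" "Ck_on k S f" "Ck_on k S g"
  shows "Ck_on k S (\<lambda>x. f x + g x)"
  using assms(2,3)
proof (induction k arbitrary: f g)
  case 0
  then show ?case
    by (simp add: continuous_on_add)
next
  case (Suc k)
  show ?case
    using Ck_on_SucD[OF Suc.prems(1)] Ck_on_SucD[OF Suc.prems(2)] assms(1) Suc.IH
    by (intro Ck_on_SucI[where
          f' = "\<lambda>x v. frechet_derivative f (at x) v + frechet_derivative g (at x) v"]
        has_derivative_add) auto
qed

text \<open>The Leibniz terms pair one factor with a derivative of the other, so the induction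
  generalises over both factors. Products, scalar multiples and inner products are
  instances.\<close>

lemma Ck_on_bilinear:
  assumes "bounded_bilinear h" "open S" "Ck_on k S f" "Ck_on k S g"
  shows "Ck_on k S (\<lambda>x. h (f x) (g x))"
  using assms(3,4)
proof (induction k arbitrary: f g)
  case 0
  then show ?case
    using bounded_bilinear.continuous_on[OF assms(1)] by simp
next
  case (Suc k)
  show ?case
    using Ck_on_SucD[OF Suc.prems(1)] Ck_on_SucD[OF Suc.prems(2)] assms(2) Suc.IH
    by (intro Ck_on_SucI[where f' = "\<lambda>x v. h (f x) (frechet_derivative g (at x) v)
          + h (frechet_derivative f (at x) v) (g x)"] Ck_on_add
        bounded_bilinear.FDERIV[OF assms(1)]) auto
qed

text \<open>The derivative of 1/f is built from 1/f itself and the derivative of f, so the induction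
  keeps \<open>f\<close> fixed and uses its own conclusion one order lower.\<close>

lemma Ck_on_inverse:
  fixes f :: "'a::euclidean_space \<Rightarrow> 'b::{euclidean_space, real_normed_div_algebra}"
  assumes "open S" "Ck_on k S f" "\<And>x. x \<in> S \<Longrightarrow> f x \<noteq> 0"
  shows "Ck_on k S (\<lambda>x. inverse (f x))"
  using assms(2)
proof (induction k)
  case 0
  then show ?case
    using assms(3) by (auto intro: continuous_on_inverse)
next
  case (Suc k)
  note D = Ck_on_SucD[OF Suc.prems]
  have "Ck_on k S (\<lambda>x. - (inverse (f x) * frechet_derivative f (at x) v * inverse (f x)))" for v
    using Suc.IH D assms(1)
    by (intro Ck_on_bounded_linear[OF bounded_linear_minus] bounded_linear_ident
          Ck_on_bilinear[OF bounded_bilinear_mult]) auto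
  then show ?case
    using D assms by (intro Ck_on_SucI[where f' = "\<lambda>x v. - (inverse (f x) *
          frechet_derivative f (at x) v * inverse (f x))"] Deriv.has_derivative_inverse) auto
qed

lemma Ck_on_sqrt:
  assumes "open S" "Ck_on k S f" "\<And>x. x \<in> S \<Longrightarrow> f x > 0"
  shows "Ck_on k S (\<lambda>x. sqrt (f x))"
  using assms(2)
proof (induction k)
  case 0
  then show ?case
    by (auto intro: continuous_on_real_sqrt)
next
  case (Suc k)
  note D = Ck_on_SucD[OF Suc.prems]
  \<comment> \<open>As for the inverse, \<open>sqrt\<close> of the same \<open>f\<close> reappears
    in its derivative, now under the rule for inverses.\<close>
  have "Ck_on k S (\<lambda>x. frechet_derivative f (at x) v * (inverse (sqrt (f x)) / 2))" for v
  proof -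
    have "Ck_on k S (\<lambda>x. inverse (sqrt (f x)))"
      using Suc.IH D assms by (intro Ck_on_inverse) (auto dest: less_imp_le assms(3) simp: assms(3)[THEN less_imp_neq, symmetric])
    then show ?thesis
      using D assms(1) by (intro Ck_on_bilinear[OF bounded_bilinear_mult]
          Ck_on_bounded_linear[OF bounded_linear_divide]) auto
  qed
  moreover have "((\<lambda>x. sqrt (f x)) has_derivative
      (\<lambda>v. frechet_derivative f (at x) v * (inverse (sqrt (f x)) / 2))) (at x)" if "x \<in> S" for x
    using DERIV_compose_FDERIV[OF DERIV_real_sqrt[OF assms(3)[OF that]] D(1)[OF that]] .
  ultimately show ?case
    using assms by (intro Ck_on_SucI[where f' = "\<lambda>x v. frechet_derivative f (at x) v *
          (inverse (sqrt (f x)) / 2)"]) auto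
qed

named_theorems smooth_intros

lemma smooth_on_cong: "open S \<Longrightarrow> (\<And>x. x \<in> S \<Longrightarrow> f x = g x) \<Longrightarrow> smooth_on S f \<longleftrightarrow> smooth_on S g"
  unfolding smooth_on_def using Ck_on_cong by blast

lemma smooth_on_const [smooth_intros]: "open S \<Longrightarrow> smooth_on S (\<lambda>x. c)"
  by (simp add: smooth_on_def Ck_on_const)

lemma smooth_on_id [smooth_intros]: "open S \<Longrightarrow> smooth_on S (\<lambda>x. x)"
  by (simp add: smooth_on_def Ck_on_id)

lemma smooth_on_bounded_linear:
  "bounded_linear h \<Longrightarrow> open S \<Longrightarrow> smooth_on S f \<Longrightarrow> smooth_on S (\<lambda>x. h (f x))"
  by (simp add: smooth_on_def Ck_on_bounded_linear)

lemma smooth_on_bilinear: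
  "bounded_bilinear h \<Longrightarrow> open S \<Longrightarrow> smooth_on S f \<Longrightarrow> smooth_on S g
    \<Longrightarrow> smooth_on S (\<lambda>x. h (f x) (g x))"
  by (simp add: smooth_on_def Ck_on_bilinear)

lemma smooth_on_add [smooth_intros]:
  "open S \<Longrightarrow> smooth_on S f \<Longrightarrow> smooth_on S g \<Longrightarrow> smooth_on S (\<lambda>x. f x + g x)"
  by (simp add: smooth_on_def Ck_on_add)

lemma smooth_on_inverse [smooth_intros]:
  fixes f :: "'a::euclidean_space \<Rightarrow> 'b::{euclidean_space, real_normed_div_algebra}"
  shows "open S \<Longrightarrow> smooth_on S f \<Longrightarrow> (\<And>x. x \<in> S \<Longrightarrow> f x \<noteq> 0) \<Longrightarrow> smooth_on S (\<lambda>x. inverse (f x))"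
  by (simp add: smooth_on_def Ck_on_inverse)

lemma smooth_on_sqrt [smooth_intros]:
  "open S \<Longrightarrow> smooth_on S f \<Longrightarrow> (\<And>x. x \<in> S \<Longrightarrow> f x > 0) \<Longrightarrow> smooth_on S (\<lambda>x. sqrt (f x))"
  by (simp add: smooth_on_def Ck_on_sqrt)

lemma smooth_on_minus [smooth_intros]:
  "open S \<Longrightarrow> smooth_on S f \<Longrightarrow> smooth_on S (\<lambda>x. - f x)"
  by (rule smooth_on_bounded_linear[OF bounded_linear_minus[OF bounded_linear_ident]])

lemma smooth_on_diff [smooth_intros]:
  "open S \<Longrightarrow> smooth_on S f \<Longrightarrow> smooth_on S g \<Longrightarrow> smooth_on S (\<lambda>x. f x - g x)"
  unfolding diff_conv_add_uminus by (intro smooth_intros)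

lemmas smooth_on_mult [smooth_intros] = smooth_on_bilinear[OF bounded_bilinear_mult]
lemmas smooth_on_scaleR [smooth_intros] = smooth_on_bilinear[OF bounded_bilinear_scaleR]
lemmas smooth_on_inner [smooth_intros] = smooth_on_bilinear[OF bounded_bilinear_inner]
lemmas smooth_on_Re [smooth_intros] = smooth_on_bounded_linear[OF bounded_linear_Re]
lemmas smooth_on_Im [smooth_intros] = smooth_on_bounded_linear[OF bounded_linear_Im]
lemmas smooth_on_cnj [smooth_intros] = smooth_on_bounded_linear[OF bounded_linear_cnj]
lemmas smooth_on_vec_nth [smooth_intros] = smooth_on_bounded_linear[OF bounded_linear_vec_nth]
lemmas smooth_on_fst [smooth_intros] = smooth_on_bounded_linear[OF bounded_linear_fst]
lemmas smooth_on_snd [smooth_intros] = smooth_on_bounded_linear[OF bounded_linear_snd]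

lemma smooth_on_of_real [smooth_intros]:
  "open S \<Longrightarrow> smooth_on S f \<Longrightarrow> smooth_on S (\<lambda>x. complex_of_real (f x))"
  by (rule smooth_on_bounded_linear[OF bounded_linear_of_real])

lemma smooth_on_power [smooth_intros]:
  fixes f :: "'a::euclidean_space \<Rightarrow> 'b::{euclidean_space, real_normed_algebra_1}"
  shows "open S \<Longrightarrow> smooth_on S f \<Longrightarrow> smooth_on S (\<lambda>x. f x ^ n)"
  by (induction n) (simp_all add: smooth_on_const smooth_on_mult)

lemma smooth_on_divide [smooth_intros]:
  fixes f g :: "'a::euclidean_space \<Rightarrow> 'b::{euclidean_space, real_normed_field}"
  shows "open S \<Longrightarrow> smooth_on S f \<Longrightarrow> smooth_on S g \<Longrightarrow> (\<And>x. x \<in> S \<Longrightarrow> g x \<noteq> 0)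
    \<Longrightarrow> smooth_on S (\<lambda>x. f x / g x)"
  unfolding divide_inverse by (intro smooth_intros)

lemma smooth_on_Pair [smooth_intros]:
  assumes "open S" "smooth_on S f" "smooth_on S g"
  shows "smooth_on S (\<lambda>x. (f x, g x))"
proof -
  have "smooth_on S (\<lambda>x. (f x, 0) + (0, g x))"
    using assms bounded_linear_Pair[OF bounded_linear_ident bounded_linear_zero]
      bounded_linear_Pair[OF bounded_linear_zero bounded_linear_ident]
    by (intro smooth_on_add) (auto intro: smooth_on_bounded_linear[where h = "\<lambda>y. (y, 0)"]
        smooth_on_bounded_linear[where h = "\<lambda>y. (0, y)"])
  then show ?thesis
    by simp
qed

lemma smooth_on_Complex [smooth_intros]:
  assumes "open S" "smooth_on S f" "smooth_on S g"
  shows "smooth_on S (\<lambda>x. Complex (f x) (g x))"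
  unfolding Complex_eq using assms by (intro smooth_intros)

lemma smooth_on_imp_has_derivative:
  "smooth_on S f \<Longrightarrow> x \<in> S \<Longrightarrow> (f has_derivative frechet_derivative f (at x)) (at x)"
  unfolding smooth_on_def by (metis Ck_on_SucD(1))

section \<open>The three-form in complex coordinates\<close>

type_synonym c4 = "complex \<times> complex \<times> complex \<times> complex"

fun herm :: "c4 \<Rightarrow> c4 \<Rightarrow> complex" where
  "herm (a1, a2, a3, a4) (b1, b2, b3, b4) = cnj a1 * b1 + cnj a2 * b2 + cnj a3 * b3 + cnj a4 * b4"

fun csymp :: "c4 \<Rightarrow> c4 \<Rightarrow> complex" where
  "csymp (a1, a2, a3, a4) (b1, b2, b3, b4) = a2 * b3 - a3 * b2 + a4 * b1 - a1 * b4"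

text \<open>Through \<open>cz\<close> below, \<open>herm x\<close> is \<open>dR/2 + i \<alpha>\<^sub>1\<close> and \<open>csymp x\<close> is \<open>\<alpha>\<^sub>2 - i \<alpha>\<^sub>3\<close>; \<open>phi_half\<close>, the
  cyclic sum of \<open>phi_half1\<close>, is \<open>\<phi>/2\<close>.\<close>

definition phi_half1 :: "c4 \<Rightarrow> c4 \<Rightarrow> c4 \<Rightarrow> c4 \<Rightarrow> real" where
  "phi_half1 x X Y Z = 2 * Re (herm x x) * Re (herm x X) * Im (herm Y Z)
     - Re (herm x X) * Im (cnj (csymp x Y) * csymp x Z)
     + Re (herm x x) * Im (csymp Y Z * cnj (csymp x X))"

definition phi_half :: "c4 \<Rightarrow> c4 \<Rightarrow> c4 \<Rightarrow> c4 \<Rightarrow> real" where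
  "phi_half x X Y Z = phi_half1 x X Y Z + phi_half1 x Y Z X + phi_half1 x Z X Y"

text \<open>The arguments \<open>kv \<dots>\<close> parametrise \<open>ker df \<inter> ker db\<close> at \<open>w = (1, 0)\<close>, \<open>w' = (m, q)\<close>. The
  parameter \<open>s\<close> is chosen so that no division is needed, and \<open>t\<close> is the direction of the circle action.\<close>

lemma phi_half_core:
  fixes m q :: real
  defines "v \<equiv> m\<^sup>2 + q\<^sup>2"
  defines "kv \<equiv> (\<lambda>b1 b2 g2 t s. (Complex (v * q * s) t, Complex b1 b2,
      Complex (- (m * (v * q * s) + q * b1)) (m * t + q * b2),
      Complex ((1 + m\<^sup>2 * v) * s + m * b1) (g2 - m * b2 + q * t)))"
  shows "phi_half (1, 0, of_real m, of_real q) (kv b1 b2 g2 t s) (kv b1' b2' g2' t' s')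
     (kv b1'' b2'' g2'' t'' s'') = 0"
proof -
  define x :: c4 where "x = (1, 0, of_real m, of_real q)"
  \<comment> \<open>Up to sign, \<open>g\<close> is the real part of \<open>csymp x\<close> on the
    kernel; see fact 3.\<close>
  define g where "g b1 s = (1 + m\<^sup>2 * v - q\<^sup>2 * v) * s + 2 * m * b1" for b1 s
  have 1: "Re (herm x x) = 1 + v"
    by (simp add: x_def v_def power2_eq_square)
  have 2: "Re (herm x (kv b1 b2 g2 t s)) = (1 + v) * (q * s)" for b1 b2 g2 t s
    by (simp add: x_def kv_def) (simp add: v_def algebra_simps power2_eq_square)
  have 3: "Re (csymp x (kv b1 b2 g2 t s)) = - g b1 s"
     "Im (csymp x (kv b1 b2 g2 t s)) = - g2" for b1 b2 g2 t s
    by (simp_all add: x_def kv_def g_def) (simp add: v_def algebra_simps power2_eq_square)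
  have 4: "Re (csymp (kv b1 b2 g2 t s) (kv b1' b2' g2' t' s')) = t * g2' - t' * g2"
     "Im (csymp (kv b1 b2 g2 t s) (kv b1' b2' g2' t' s')) =
      - v * q * (s * g2' - s' * g2) - (t * g b1' s' - t' * g b1 s) + 2 * m * v * q * (s * b2' - s' * b2)
      + 2 * q * (b1 * b2' - b2 * b1')" for b1 b2 g2 t s b1' b2' g2' t' s'
    by (simp_all add: x_def kv_def g_def) (simp_all add: v_def algebra_simps power2_eq_square)
  have 5: "Im (herm (kv b1 b2 g2 t s) (kv b1' b2' g2' t' s')) =
      (1 - v) * (b1 * b2' - b2 * b1') + m * (b1 * g2' - g2 * b1')
      + (v * q - m\<^sup>2 * v * q + (1 + m\<^sup>2 * v) * q) * (s * t' - s' * t)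
      - (m * v * q\<^sup>2 + m * (1 + m\<^sup>2 * v)) * (s * b2' - s' * b2)
      + (1 + m\<^sup>2 * v) * (s * g2' - s' * g2)" for b1 b2 g2 t s b1' b2' g2' t' s'
    by (simp add: kv_def) (simp add: v_def algebra_simps power2_eq_square)
  \<comment> \<open>By facts 1 to 3 every summand contains the factor 1 + v, the value of R at the
    base point; it is split off before taking the cyclic sum.\<close>
  have "phi_half1 x (kv b1 b2 g2 t s) (kv b1' b2' g2' t' s') (kv b1'' b2'' g2'' t'' s'') =
    (1 + v) * (2 * (1 + v) * (q * s) * Im (herm (kv b1' b2' g2' t' s') (kv b1'' b2'' g2'' t'' s''))
    - q * s * (g b1' s' * g2'' - g2' * g b1'' s'')
    + (g2 * Re (csymp (kv b1' b2' g2' t' s') (kv b1'' b2'' g2'' t'' s''))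
    - g b1 s * Im (csymp (kv b1' b2' g2' t' s') (kv b1'' b2'' g2'' t'' s''))))" 
    for b1 b2 g2 t s b1' b2' g2' t' s' b1'' b2'' g2'' t'' s''
    unfolding phi_half1_def by (simp add: 1 2 3) (simp add: algebra_simps)
  moreover have "2 * (1 + v) * (q * s) * Im (herm (kv b1' b2' g2' t' s') (kv b1'' b2'' g2'' t'' s''))
    - q * s * (g b1' s' * g2'' - g2' * g b1'' s'')
    + (g2 * Re (csymp (kv b1' b2' g2' t' s') (kv b1'' b2'' g2'' t'' s''))
    - g b1 s * Im (csymp (kv b1' b2' g2' t' s') (kv b1'' b2'' g2'' t'' s''))) 
    + (2 * (1 + v) * (q * s') * Im (herm (kv b1'' b2'' g2'' t'' s'') (kv b1 b2 g2 t s))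
    - q * s' * (g b1'' s'' * g2 - g2'' * g b1 s)
    + (g2' * Re (csymp (kv b1'' b2'' g2'' t'' s'') (kv b1 b2 g2 t s))
    - g b1' s' * Im (csymp (kv b1'' b2'' g2'' t'' s'') (kv b1 b2 g2 t s)))) 
    + (2 * (1 + v) * (q * s'') * Im (herm (kv b1 b2 g2 t s) (kv b1' b2' g2' t' s'))
    - q * s'' * (g b1 s * g2' - g2 * g b1' s')
    + (g2'' * Re (csymp (kv b1 b2 g2 t s) (kv b1' b2' g2' t' s'))
    - g b1'' s'' * Im (csymp (kv b1 b2 g2 t s) (kv b1' b2' g2' t' s')))) = 0"
  proof -
    define L where "L = 1 + m\<^sup>2 * v - q\<^sup>2 * v"
    have g: "g b1 s = L * s + 2 * m * b1" for b1 s
      by (simp add: g_def L_def)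
    \<comment> \<open>The determinant with rows a, b, c. The cyclic sums are combinations of such
      determinants; those with a repeated row vanish, which leaves only the rows (s, b1, b2) and (s,
      b1, g2).\<close>
    define dd where "dd a a' a'' b b' b'' c c' c'' =
        a * (b' * c'' - b'' * c') + a' * (b'' * c - b * c'') + a'' * (b * c' - b' * c)"
      for a a' a'' b b' b'' c c' c'' :: real
    have H: "s * Im (herm (kv b1' b2' g2' t' s') (kv b1'' b2'' g2'' t'' s''))
      + s' * Im (herm (kv b1'' b2'' g2'' t'' s'') (kv b1 b2 g2 t s))
      + s'' * Im (herm (kv b1 b2 g2 t s) (kv b1' b2' g2' t' s'))
      = (1 - v) * dd s s' s'' b1 b1' b1'' b2 b2' b2'' + m * dd s s' s'' b1 b1' b1'' g2 g2' g2''"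
      unfolding 5 dd_def by algebra
    have G: "s * (g b1' s' * g2'' - g2' * g b1'' s'') + s' * (g b1'' s'' * g2 - g2'' * g b1 s)
      + s'' * (g b1 s * g2' - g2 * g b1' s') = 2 * m * dd s s' s'' b1 b1' b1'' g2 g2' g2''"
      unfolding g dd_def by algebra
    have C: "g2 * Re (csymp (kv b1' b2' g2' t' s') (kv b1'' b2'' g2'' t'' s''))
      + g2' * Re (csymp (kv b1'' b2'' g2'' t'' s'') (kv b1 b2 g2 t s))
      + g2'' * Re (csymp (kv b1 b2 g2 t s) (kv b1' b2' g2' t' s')) = 0"
      unfolding 4 by algebra
    have D: "g b1 s * Im (csymp (kv b1' b2' g2' t' s') (kv b1'' b2'' g2'' t'' s''))
      + g b1' s' * Im (csymp (kv b1'' b2'' g2'' t'' s'') (kv b1 b2 g2 t s))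
      + g b1'' s'' * Im (csymp (kv b1 b2 g2 t s) (kv b1' b2' g2' t' s'))
      = 2 * m * v * q * dd s s' s'' b1 b1' b1'' g2 g2' g2''
        + (2 * q * L - 4 * m\<^sup>2 * v * q) * dd s s' s'' b1 b1' b1'' b2 b2' b2''"
      unfolding 4 g dd_def by algebra
    \<comment> \<open>This relation, which rests on v = m^2 + q^2, cancels the coefficient of the
      determinant \<open>p\<close>; the coefficient of \<open>r\<close> cancels outright.\<close>
    have "(1 - v) * (1 + v) = L - 2 * m\<^sup>2 * v"
      unfolding L_def by (simp add: v_def algebra_simps power2_eq_square)
    then have "2 * (1 + v) * q * ((1 - v) * p + m * r) - q * (2 * m * r) + 0
      - (2 * m * v * q * r + (2 * q * L - 4 * m\<^sup>2 * v * q) * p) = 0" for p r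
      by algebra
    from this[of "dd s s' s'' b1 b1' b1'' b2 b2' b2''" "dd s s' s'' b1 b1' b1'' g2 g2' g2''"]
    show ?thesis
      unfolding H[symmetric] G[symmetric] C[symmetric] D[symmetric] by (simp add: algebra_simps)
  qed
  ultimately show ?thesis
    unfolding phi_half_def x_def[symmetric] by (simp only: distrib_left[symmetric])
qed

text \<open>\<open>mix\<close> and \<open>db4\<close> are the derivatives of \<open>f_plus\<close> and \<open>b_fun / 4\<close>.\<close>

fun mix :: "c4 \<Rightarrow> c4 \<Rightarrow> complex" where
  "mix (a1, a2, a3, a4) (b1, b2, b3, b4) = a1 * cnj b3 + a2 * cnj b4 + b1 * cnj a3 + b2 * cnj a4"

fun db4 :: "c4 \<Rightarrow> c4 \<Rightarrow> real" where
  "db4 (a1, a2, a3, a4) (b1, b2, b3, b4) =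
     Re (cnj a1 * a1 + cnj a2 * a2) * Re (cnj a1 * b1 + cnj a2 * b2)
     - Re (cnj a3 * a3 + cnj a4 * a4) * Re (cnj a3 * b3 + cnj a4 * b4)"

text \<open>The coordinates of \<open>w\<close> and of \<open>w'\<close> refer to the moving basis \<open>(w1, w2)\<close>, \<open>(- cnj w2, cnj w1)\<close>;
  the unit factors \<open>r\<close> and \<open>s\<close> serve to make the coordinates of \<open>w'\<close> at the base point real.\<close>

fun frm :: "complex \<Rightarrow> complex \<Rightarrow> complex \<Rightarrow> complex \<Rightarrow> c4 \<Rightarrow> c4" where
  "frm w1 w2 r s (a1, a2, a3, a4) = (a1 * w1 - s * a2 * cnj w2, a1 * w2 + s * a2 * cnj w1,
     r * (a3 * w1 - s * a4 * cnj w2), r * (a3 * w2 + s * a4 * cnj w1))"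

section \<open>Behaviour under unitary changes of basis\<close>

lemma Re_Im_of_real_mult: "Re (of_real k * z) = k * Re z" "Im (of_real k * z) = k * Im z"
  by simp_all

text \<open>Capital letters stand for conjugates. As independent variables they turn the claims into
  polynomial identities in which only \<open>R * r\<close>, \<open>S * s\<close> and
  \<open>W1 * w1 + W2 * w2\<close> have to be replaced.\<close>

lemma frm_identities:
  fixes w1 w2 W1 W2 r R s S u a1 a2 a3 a4 b1 b2 b3 b4 A1 A2 A3 A4 B3 B4 :: complex
  assumes u: "W1 * w1 + W2 * w2 = u" and r: "R * r = 1" and s: "S * s = 1"
  shows "(A1 * W1 - S * A2 * w2) * (b1 * w1 - s * b2 * W2) + (A1 * W2 + S * A2 * w1) * (b1 * w2 + s * b2 * W1)
      = u * (A1 * b1 + A2 * b2)"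
    and "(A1 * W1 - S * A2 * w2) * (b1 * w1 - s * b2 * W2) + (A1 * W2 + S * A2 * w1) * (b1 * w2 + s * b2 * W1)
      + R * (A3 * W1 - S * A4 * w2) * (r * (b3 * w1 - s * b4 * W2))
      + R * (A3 * W2 + S * A4 * w1) * (r * (b3 * w2 + s * b4 * W1))
      = u * (A1 * b1 + A2 * b2 + A3 * b3 + A4 * b4)"
    and "(a1 * w2 + s * a2 * W1) * (r * (b3 * w1 - s * b4 * W2))
      - r * (a3 * w1 - s * a4 * W2) * (b1 * w2 + s * b2 * W1)
      + r * (a3 * w2 + s * a4 * W1) * (b1 * w1 - s * b2 * W2)
      - (a1 * w1 - s * a2 * W2) * (r * (b3 * w2 + s * b4 * W1))
      = u * (r * s) * (a2 * b3 - a3 * b2 + a4 * b1 - a1 * b4)"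
    and "(a1 * w1 - s * a2 * W2) * (R * (B3 * W1 - S * B4 * w2))
      + (a1 * w2 + s * a2 * W1) * (R * (B3 * W2 + S * B4 * w1))
      + (b1 * w1 - s * b2 * W2) * (R * (A3 * W1 - S * A4 * w2))
      + (b1 * w2 + s * b2 * W1) * (R * (A3 * W2 + S * A4 * w1))
      = u * R * (a1 * B3 + a2 * B4 + b1 * A3 + b2 * A4)"
    and "R * A1 * (r * b1) + R * A2 * (r * b2) = A1 * b1 + A2 * b2"
    and "u * (R * S) * A1 * (u * (r * s) * b1) = u\<^sup>2 * (A1 * b1)"
    and "b1 * u = (W1 * b1 + W2 * b2) * w1 - s * (S * (w1 * b2 - w2 * b1)) * W2"
    and "b2 * u = (W1 * b1 + W2 * b2) * w2 + s * (S * (w1 * b2 - w2 * b1)) * W1"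
    and "R * b1 = a1 \<Longrightarrow> b1 = r * a1"
proof -
  have "(A1 * W1 - S * A2 * w2) * (b1 * w1 - s * b2 * W2) + (A1 * W2 + S * A2 * w1) * (b1 * w2 + s * b2 * W1)
      = (W1 * w1 + W2 * w2) * (A1 * b1 + (S * s) * (A2 * b2))"
    by (simp add: algebra_simps power2_eq_square)
  then show "(A1 * W1 - S * A2 * w2) * (b1 * w1 - s * b2 * W2) + (A1 * W2 + S * A2 * w1) * (b1 * w2 + s * b2 * W1)
      = u * (A1 * b1 + A2 * b2)"
    by (simp add: u r s algebra_simps)
  have "(A1 * W1 - S * A2 * w2) * (b1 * w1 - s * b2 * W2) + (A1 * W2 + S * A2 * w1) * (b1 * w2 + s * b2 * W1)
      + R * (A3 * W1 - S * A4 * w2) * (r * (b3 * w1 - s * b4 * W2))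
      + R * (A3 * W2 + S * A4 * w1) * (r * (b3 * w2 + s * b4 * W1))
      = (W1 * w1 + W2 * w2) * (A1 * b1 + (S * s) * (A2 * b2) + (R * r) * (A3 * b3 + (S * s) * (A4 * b4)))"
    by (simp add: algebra_simps power2_eq_square)
  then show "(A1 * W1 - S * A2 * w2) * (b1 * w1 - s * b2 * W2) + (A1 * W2 + S * A2 * w1) * (b1 * w2 + s * b2 * W1)
      + R * (A3 * W1 - S * A4 * w2) * (r * (b3 * w1 - s * b4 * W2))
      + R * (A3 * W2 + S * A4 * w1) * (r * (b3 * w2 + s * b4 * W1))
      = u * (A1 * b1 + A2 * b2 + A3 * b3 + A4 * b4)"
    by (simp add: u r s algebra_simps)
  have "(a1 * w2 + s * a2 * W1) * (r * (b3 * w1 - s * b4 * W2))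
      - r * (a3 * w1 - s * a4 * W2) * (b1 * w2 + s * b2 * W1)
      + r * (a3 * w2 + s * a4 * W1) * (b1 * w1 - s * b2 * W2)
      - (a1 * w1 - s * a2 * W2) * (r * (b3 * w2 + s * b4 * W1))
      = (W1 * w1 + W2 * w2) * (r * s) * (a2 * b3 - a3 * b2 + a4 * b1 - a1 * b4)"
    by (simp add: algebra_simps power2_eq_square)
  then show "(a1 * w2 + s * a2 * W1) * (r * (b3 * w1 - s * b4 * W2))
      - r * (a3 * w1 - s * a4 * W2) * (b1 * w2 + s * b2 * W1)
      + r * (a3 * w2 + s * a4 * W1) * (b1 * w1 - s * b2 * W2)
      - (a1 * w1 - s * a2 * W2) * (r * (b3 * w2 + s * b4 * W1))
      = u * (r * s) * (a2 * b3 - a3 * b2 + a4 * b1 - a1 * b4)"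
    by (simp add: u r s algebra_simps)
  have "(a1 * w1 - s * a2 * W2) * (R * (B3 * W1 - S * B4 * w2))
      + (a1 * w2 + s * a2 * W1) * (R * (B3 * W2 + S * B4 * w1))
      + (b1 * w1 - s * b2 * W2) * (R * (A3 * W1 - S * A4 * w2))
      + (b1 * w2 + s * b2 * W1) * (R * (A3 * W2 + S * A4 * w1))
      = (W1 * w1 + W2 * w2) * R * (a1 * B3 + (S * s) * (a2 * B4) + b1 * A3 + (S * s) * (b2 * A4))"
    by (simp add: algebra_simps power2_eq_square)
  then show "(a1 * w1 - s * a2 * W2) * (R * (B3 * W1 - S * B4 * w2))
      + (a1 * w2 + s * a2 * W1) * (R * (B3 * W2 + S * B4 * w1))
      + (b1 * w1 - s * b2 * W2) * (R * (A3 * W1 - S * A4 * w2))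
      + (b1 * w2 + s * b2 * W1) * (R * (A3 * W2 + S * A4 * w1))
      = u * R * (a1 * B3 + a2 * B4 + b1 * A3 + b2 * A4)"
    by (simp add: u r s algebra_simps)
  have "R * A1 * (r * b1) + R * A2 * (r * b2)
      = (R * r) * (A1 * b1 + A2 * b2)"
    by (simp add: algebra_simps power2_eq_square)
  then show "R * A1 * (r * b1) + R * A2 * (r * b2) = A1 * b1 + A2 * b2"
    by (simp add: u r s algebra_simps)
  have "u * (R * S) * A1 * (u * (r * s) * b1)
      = u\<^sup>2 * ((R * r) * (S * s) * (A1 * b1))"
    by (simp add: algebra_simps power2_eq_square)
  then show "u * (R * S) * A1 * (u * (r * s) * b1) = u\<^sup>2 * (A1 * b1)"
    by (simp add: u r s algebra_simps)
  have e: "s * (S * z) = z" for z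
    using s by (simp add: mult.assoc[symmetric] mult.commute)
  show "b1 * u = (W1 * b1 + W2 * b2) * w1 - s * (S * (w1 * b2 - w2 * b1)) * W2" "b2 * u = (W1 * b1 + W2 * b2) * w2 + s * (S * (w1 * b2 - w2 * b1)) * W1"
    unfolding e u[symmetric] by (simp_all add: algebra_simps)
  show "b1 = r * a1" if "R * b1 = a1"
    using that r by (metis mult.assoc mult.commute mult_1)
qed

context
  fixes w1 w2 r s :: complex and u :: real
  assumes u: "cnj w1 * w1 + cnj w2 * w2 = of_real u" and r: "cnj r * r = 1" and s: "cnj s * s = 1"
begin

lemmas cnjs = complex_cnj_complex_of_real complex_cnj_mult complex_cnj_diff complex_cnj_add complex_cnj_cnj

text \<open>\<open>frm\<close> acts on \<open>w\<close> by a 2x2 matrix with orthogonal columns of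
  squared length \<open>u\<close>, and on \<open>w'\<close> by \<open>r\<close> times this
  matrix.\<close>

lemma herm_frm: "herm (frm w1 w2 r s a) (frm w1 w2 r s b) = of_real u * herm a b"
proof (cases a; cases b)
  fix a1 a2 a3 a4 b1 b2 b3 b4 :: complex
  assume a: "a = (a1, a2, a3, a4)" and b: "b = (b1, b2, b3, b4)"
  show ?thesis
    unfolding a b herm.simps frm.simps cnjs by (rule frm_identities[OF u r s])
qed

text \<open>\<open>csymp\<close> is made of 2x2 determinants of one \<open>w\<close> against one
  \<open>w'\<close>, so it is scaled by \<open>r\<close> times the determinant \<open>u * s\<close>
  of the matrix acting on \<open>w\<close>.\<close>

lemma csymp_frm: "csymp (frm w1 w2 r s a) (frm w1 w2 r s b) = of_real u * (r * s) * csymp a b"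
proof (cases a; cases b)
  fix a1 a2 a3 a4 b1 b2 b3 b4 :: complex
  assume a: "a = (a1, a2, a3, a4)" and b: "b = (b1, b2, b3, b4)"
  show ?thesis
    unfolding a b csymp.simps frm.simps cnjs by (rule frm_identities[OF u r s])
qed

lemma mix_frm: "mix (frm w1 w2 r s a) (frm w1 w2 r s b) = of_real u * cnj r * mix a b"
proof (cases a; cases b)
  fix a1 a2 a3 a4 b1 b2 b3 b4 :: complex
  assume a: "a = (a1, a2, a3, a4)" and b: "b = (b1, b2, b3, b4)"
  show ?thesis
    unfolding a b mix.simps frm.simps cnjs by (rule frm_identities[OF u r s])
qed

lemma db4_frm: "db4 (frm w1 w2 r s a) (frm w1 w2 r s b) = u\<^sup>2 * db4 a b"
proof (cases a; cases b)
  fix a1 a2 a3 a4 b1 b2 b3 b4 :: complex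
  assume a: "a = (a1, a2, a3, a4)" and b: "b = (b1, b2, b3, b4)"
  let ?h = "\<lambda>a1 a2 b1 b2 :: complex. cnj a1 * b1 + cnj a2 * b2"
  have "?h (a1 * w1 - s * a2 * cnj w2) (a1 * w2 + s * a2 * cnj w1) (b1 * w1 - s * b2 * cnj w2)
     (b1 * w2 + s * b2 * cnj w1) = of_real u * ?h a1 a2 b1 b2" for a1 a2 b1 b2
    unfolding cnjs by (rule frm_identities[OF u r s])
  moreover have "?h (r * a1) (r * a2) (r * b1) (r * b2) = ?h a1 a2 b1 b2" for a1 a2 b1 b2
    unfolding cnjs by (rule frm_identities[OF u r s])
  ultimately have "Re (?h (a1 * w1 - s * a2 * cnj w2) (a1 * w2 + s * a2 * cnj w1)
      (b1 * w1 - s * b2 * cnj w2) (b1 * w2 + s * b2 * cnj w1)) = u * Re (?h a1 a2 b1 b2)"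
    "Re (?h (r * (a1 * w1 - s * a2 * cnj w2)) (r * (a1 * w2 + s * a2 * cnj w1))
      (r * (b1 * w1 - s * b2 * cnj w2)) (r * (b1 * w2 + s * b2 * cnj w1))) = u * Re (?h a1 a2 b1 b2)"
    for a1 a2 b1 b2
    by (simp_all only: Re_Im_of_real_mult)
  then show ?thesis
    unfolding a b frm.simps db4.simps by (simp only:) (simp add: algebra_simps power2_eq_square)
qed

text \<open>The phases cancel because \<open>csymp\<close> occurs only next to a conjugate of
  itself; each term has degree three in the scale \<open>u\<close>.\<close>

lemma phi_half_frm:
  "phi_half (frm w1 w2 r s x) (frm w1 w2 r s X) (frm w1 w2 r s Y) (frm w1 w2 r s Z)
   = u ^ 3 * phi_half x X Y Z"
proof -
  have c: "cnj (of_real u * (r * s) * a) * (of_real u * (r * s) * b) = of_real (u\<^sup>2) * (cnj a * b)"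
     "(of_real u * (r * s) * a) * cnj (of_real u * (r * s) * b) = of_real (u\<^sup>2) * (a * cnj b)" for a b
    unfolding cnjs of_real_power
    by (rule frm_identities[OF u r s], subst (1 2) mult.commute, rule frm_identities[OF u r s])
  have "phi_half1 (frm w1 w2 r s x) (frm w1 w2 r s X) (frm w1 w2 r s Y) (frm w1 w2 r s Z)
   = u ^ 3 * phi_half1 x X Y Z" for X Y Z
    unfolding phi_half1_def herm_frm csymp_frm c Re_Im_of_real_mult
    by (simp add: algebra_simps power2_eq_square power3_eq_cube)
  then show ?thesis
    by (simp add: phi_half_def algebra_simps)
qed

lemma frm_surj:
  assumes "u \<noteq> 0"
  obtains a where "b = frm w1 w2 r s a"
proof -
  obtain b1 b2 b3 b4 where b: "b = (b1, b2, b3, b4)"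
    by (cases b)
  have *: "\<exists>a1 a2. c1 = a1 * w1 - s * a2 * cnj w2 \<and> c2 = a1 * w2 + s * a2 * cnj w1" for c1 c2
  proof (intro exI conjI)
    let ?u = "complex_of_real u"
    have "?u \<noteq> 0"
      using assms by simp
    \<comment> \<open>Coefficients in an orthogonal basis: inner products with the basis vectors,
      divided by their squared length \<open>u\<close>.\<close>
    then show "c1 = ((cnj w1 * c1 + cnj w2 * c2) / ?u) * w1
        - s * (cnj s * (w1 * c2 - w2 * c1) / ?u) * cnj w2"
      "c2 = ((cnj w1 * c1 + cnj w2 * c2) / ?u) * w2
        + s * (cnj s * (w1 * c2 - w2 * c1) / ?u) * cnj w1"
      by (simp_all add: divide_simps) (rule frm_identities[OF u r s])+
  qed
  obtain a1 a2 where "b1 = a1 * w1 - s * a2 * cnj w2" "b2 = a1 * w2 + s * a2 * cnj w1"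
    using *[of b1 b2] by auto
  moreover obtain a3 a4 where "cnj r * b3 = a3 * w1 - s * a4 * cnj w2"
     "cnj r * b4 = a3 * w2 + s * a4 * cnj w1"
    using *[of "cnj r * b3" "cnj r * b4"] by auto
  then have "b3 = r * (a3 * w1 - s * a4 * cnj w2)" "b4 = r * (a3 * w2 + s * a4 * cnj w1)"
    by (auto intro!: frm_identities(9)[OF u r s])
  ultimately show ?thesis
    using that[of "(a1, a2, a3, a4)"] b by simp
qed

end

section \<open>Vanishing of the form on the common kernel of df and db\<close>

lemma phi_half_eq_0_normal:
  fixes m q :: real
  defines "x \<equiv> (1, 0, of_real m, of_real q) :: c4"
  assumes "mix x X = 0" "mix x Y = 0" "mix x Z = 0" "db4 x X = 0" "db4 x Y = 0" "db4 x Z = 0"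
  shows "phi_half x X Y Z = 0"
proof -
  define v where "v = m\<^sup>2 + q\<^sup>2"
  define kv where "kv = (\<lambda>b1 b2 g2 t s. (Complex (v * q * s) t, Complex b1 b2,
      Complex (- (m * (v * q * s) + q * b1)) (m * t + q * b2),
      Complex ((1 + m\<^sup>2 * v) * s + m * b1) (g2 - m * b2 + q * t)))"
  \<comment> \<open>\<open>mix = 0\<close> determines the third entry from the first two, and
    \<open>db4 = 0\<close> then determines \<open>Re X1\<close>; the remaining real coordinates are
    free.\<close>
  have *: "\<exists>b1 b2 g2 t s. X = kv b1 b2 g2 t s" if X: "mix x X = 0" "db4 x X = 0" for X
  proof -
    obtain X1 X2 X3 X4 where X_eq: "X = (X1, X2, X3, X4)"
      by (cases X)
    have X3: "Re X3 = - (m * Re X1 + q * Re X2)" "Im X3 = m * Im X1 + q * Im X2"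
      using X(1) by (simp_all add: x_def X_eq complex_eq_iff algebra_simps)
    have "Re X1 = v * (m * Re X3 + q * Re X4)"
      using X(2) by (simp add: x_def X_eq v_def power2_eq_square)
    then have e: "(1 + m\<^sup>2 * v) * Re X1 = v * (q * (Re X4 - m * Re X2))"
      unfolding X3 by (simp add: algebra_simps power2_eq_square)
    have k: "1 + m\<^sup>2 * v > 0"
      unfolding v_def by (intro add_pos_nonneg) auto
    \<comment> \<open>The only division of the parametrisation, by a positive number, happens
      here.\<close>
    define s where "s = (Re X4 - m * Re X2) / (1 + m\<^sup>2 * v)"
    have s: "(1 + m\<^sup>2 * v) * s = Re X4 - m * Re X2"
      using k by (simp add: s_def)
    have "(1 + m\<^sup>2 * v) * Re X1 = (1 + m\<^sup>2 * v) * (v * q * s)"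
      unfolding e s[symmetric] by (simp add: algebra_simps)
    with k have "Re X1 = v * q * s"
      by (metis mult_cancel_left less_irrefl)
    with s X3 have "X = kv (Re X2) (Im X2) (Im X4 + m * Im X2 - q * Im X1) (Im X1) s"
      unfolding X_eq kv_def by (simp add: complex_eq_iff)
    then show ?thesis
      by blast
  qed
  obtain b1 b2 g2 t s b1' b2' g2' t' s' b1'' b2'' g2'' t'' s''
    where "X = kv b1 b2 g2 t s" "Y = kv b1' b2' g2' t' s'" "Z = kv b1'' b2'' g2'' t'' s''"
    using *[of X] *[of Y] *[of Z] assms(2-) by metis
  then show ?thesis
    unfolding kv_def v_def x_def by (simp only: phi_half_core)
qed

lemma complex_polar: "\<exists>r. cnj r * r = 1 \<and> z = r * of_real (cmod z)"
proof (cases "z = 0")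
  case True
  then show ?thesis
    by (intro exI[of _ 1]) simp
next
  case False
  have "sgn z * of_real (cmod z) = z"
    using False by (simp add: sgn_eq)
  moreover have "cnj (sgn z) * sgn z = 1"
    using False complex_norm_square[of "sgn z"] by (simp add: norm_sgn mult.commute)
  ultimately show ?thesis
    by metis
qed

text \<open>Reduction to the normal form: \<open>w\<close> becomes the first basis vector,
  \<open>r\<close> removes the phase of the first coefficient of \<open>w'\<close>, and
  \<open>s\<close> the phase that this leaves in the second.\<close>

lemma phi_half_eq_0_aux:
  assumes "(w1, w2) \<noteq> (0, 0)"
  assumes x: "x = (w1, w2, w3, w4)"
  assumes "mix x X = 0" "mix x Y = 0" "mix x Z = 0" "db4 x X = 0" "db4 x Y = 0" "db4 x Z = 0"
  shows "phi_half x X Y Z = 0"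
proof -
  define u where "u = (cmod w1)\<^sup>2 + (cmod w2)\<^sup>2"
  have u: "cnj w1 * w1 + cnj w2 * w2 = of_real u"
    using complex_norm_square[of w1] complex_norm_square[of w2] by (simp add: u_def mult.commute)
  have u0: "u \<noteq> 0"
    using assms(1) by (simp add: u_def add_nonneg_eq_0_iff)
  \<comment> \<open>\<open>mm\<close> and \<open>nn\<close> are the coefficients of
    \<open>w'\<close> in the basis \<open>(w1, w2)\<close>,
    \<open>(- cnj w2, cnj w1)\<close>.\<close>
  define mm where "mm = (cnj w1 * w3 + cnj w2 * w4) / of_real u"
  define nn where "nn = (w1 * w4 - w2 * w3) / of_real u"
  obtain r where r: "cnj r * r = 1" and mm: "mm = r * of_real (cmod mm)"
    using complex_polar by blast
  obtain s where s: "cnj s * s = 1" and nn: "cnj r * nn = s * of_real (cmod (cnj r * nn))"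
    using complex_polar by blast
  define q where "q = cmod (cnj r * nn)"
  note f = u r s
  have "r * (s * of_real q) = (cnj r * r) * nn"
    unfolding q_def nn[symmetric] by simp
  then have "r * (s * of_real q) = nn"
    by (simp only: r mult_1)
  moreover have "r * of_real (cmod mm) = mm"
    by (rule mm[symmetric])
  moreover have "r * (a * b - s * q * c) = r * a * b - r * (s * q) * c"
    "r * (a * b + s * q * c) = r * a * b + r * (s * q) * c" for a b c :: complex
    by (simp_all add: algebra_simps)
  ultimately have "r * (of_real (cmod mm) * w1 - s * of_real q * cnj w2) = mm * w1 - nn * cnj w2"
     "r * (of_real (cmod mm) * w2 + s * of_real q * cnj w1) = mm * w2 + nn * cnj w1"
    by simp_all
  moreover have "mm * w1 - nn * cnj w2 = w3" "mm * w2 + nn * cnj w1 = w4"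
  proof -
    have "(cnj w1 * w3 + cnj w2 * w4) * w1 - (w1 * w4 - w2 * w3) * cnj w2 = of_real u * w3"
      "(cnj w1 * w3 + cnj w2 * w4) * w2 + (w1 * w4 - w2 * w3) * cnj w1 = of_real u * w4"
      unfolding u[symmetric] by (simp_all add: algebra_simps)
    then show "mm * w1 - nn * cnj w2 = w3" "mm * w2 + nn * cnj w1 = w4"
      using u0 unfolding mm_def nn_def times_divide_eq_left diff_divide_distrib[symmetric]
        add_divide_distrib[symmetric] by simp_all
  qed
  ultimately have x': "x = frm w1 w2 r s (1, 0, of_real (cmod mm), of_real q)"
    by (simp add: x)
  obtain X0 Y0 Z0 where 0: "X = frm w1 w2 r s X0" "Y = frm w1 w2 r s Y0" "Z = frm w1 w2 r s Z0"
    using frm_surj[OF f u0] by metis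
  have "r \<noteq> 0"
    using r by auto
  with assms(3-) show ?thesis
    using u0 unfolding x' 0 mix_frm[OF f] db4_frm[OF f] phi_half_frm[OF f]
    by (simp add: phi_half_eq_0_normal)
qed

text \<open>Exchanging \<open>w\<close> and \<open>w'\<close> preserves \<open>herm\<close> and
  \<open>csymp\<close>, conjugates \<open>mix\<close> and negates \<open>db4\<close>; so the points
  with \<open>w = 0\<close> reduce to the case already treated.\<close>

lemma phi_half_eq_0:
  assumes "x \<noteq> (0, 0, 0, 0)"
  assumes "mix x X = 0" "mix x Y = 0" "mix x Z = 0" "db4 x X = 0" "db4 x Y = 0" "db4 x Z = 0"
  shows "phi_half x X Y Z = 0"
proof -
  define swap :: "c4 \<Rightarrow> c4" where "swap = (\<lambda>(a1, a2, a3, a4). (a3, a4, a1, a2))"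
  have h: "herm (swap a) (swap b) = herm a b" "csymp (swap a) (swap b) = csymp a b"
     "mix (swap a) (swap b) = cnj (mix a b)" "db4 (swap a) (swap b) = - db4 a b" for a b
    by (cases a; cases b; simp add: swap_def algebra_simps)+
  have p: "phi_half (swap x) (swap X) (swap Y) (swap Z) = phi_half x X Y Z"
    by (simp add: phi_half_def phi_half1_def h)
  obtain w1 w2 w3 w4 where x: "x = (w1, w2, w3, w4)"
    by (cases x)
  show ?thesis
  proof (cases "(w1, w2) = (0, 0)")
    case False
    then show ?thesis
      using phi_half_eq_0_aux[OF _ x] assms by blast
  next
    case True
    then have "(w3, w4) \<noteq> (0, 0)" "swap x = (w3, w4, w1, w2)"
      using assms(1) by (auto simp: x swap_def)
    then have "phi_half (swap x) (swap X) (swap Y) (swap Z) = 0"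
      by (rule phi_half_eq_0_aux) (simp_all add: h assms)
    then show ?thesis
      by (simp only: p)
  qed
qed

section \<open>The real 3-form in complex coordinates\<close>

lemma sum_8: "sum f (UNIV :: 8 set) = f 0 + f 1 + f 2 + f 3 + f 4 + f 5 + f 6 + f 7"
  unfolding UNIV_8 by (simp add: add.assoc)

lemma Y2_nth:
  "Y2 x $ 0 = - (x$2)" "Y2 x $ 1 = - (x$3)" "Y2 x $ 2 = x$0" "Y2 x $ 3 = x$1"
  "Y2 x $ 4 = - (x$6)" "Y2 x $ 5 = - (x$7)" "Y2 x $ 6 = x$4" "Y2 x $ 7 = x$5"
  by (simp_all add: Y2_def axis_def)

lemma Y3_nth:
  "Y3 x $ 0 = - (x$3)" "Y3 x $ 1 = x$2" "Y3 x $ 2 = - (x$1)" "Y3 x $ 3 = x$0"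
  "Y3 x $ 4 = - (x$7)" "Y3 x $ 5 = x$6" "Y3 x $ 6 = - (x$5)" "Y3 x $ 7 = x$4"
  by (simp_all add: Y3_def axis_def)

lemma bounded_linear_Y: "bounded_linear Y1" "bounded_linear Y2" "bounded_linear Y3"
  unfolding linear_conv_bounded_linear[symmetric]
  by (rule linearI; simp add: vec_eq_iff forall_8 Y1_nth Y2_nth Y3_nth algebra_simps)+

text \<open>The components are \<open>(w, w')\<close>.\<close>

definition cz :: "real^8 \<Rightarrow> c4" where
  "cz x = (z0 x, z2 x, z3 x, - z1 x)"

lemma inner_8: "(x :: real^8) \<bullet> y = x$0 * y$0 + x$1 * y$1 + x$2 * y$2 + x$3 * y$3
    + x$4 * y$4 + x$5 * y$5 + x$6 * y$6 + x$7 * y$7"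
  by (simp add: inner_vec_def sum_8)

lemma inner_cz:
  "x \<bullet> y = Re (herm (cz x) (cz y))" "Y1 x \<bullet> y = Im (herm (cz x) (cz y))"
  "Y2 x \<bullet> y = Re (csymp (cz x) (cz y))" "Y3 x \<bullet> y = - Im (csymp (cz x) (cz y))"
  by (simp_all add: cz_def z0_def z1_def z2_def z3_def inner_8 Y1_nth Y2_nth Y3_nth)

lemma Y1_skew: "Y1 x \<bullet> y = - (Y1 y \<bullet> x)"
  by (simp add: inner_8 Y1_nth)

lemma Rsq_inner: "Rsq x = x \<bullet> x"
  by (simp add: Rsq_def inner_vec_def power2_eq_square)

lemma e_metric_inner: "e_metric x X Y = X \<bullet> Y"
  by (simp add: e_metric_def inner_vec_def)

text \<open>The quotient rule for \<open>alpha_hat Y1\<close> produces denominators up to R^2, which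
  the factor R^3 clears. The result is polynomial in \<open>y\<close>, so the next exterior
  derivative involves no quotients.\<close>

lemma omega_eq:
  assumes "y \<noteq> 0"
  shows "1/3 * (Rsq y)^3 * omega y Y Z = 
    2/3 * (y \<bullet> y)\<^sup>2 * (Y1 Y \<bullet> Z) - 2/3 * (y \<bullet> y) * ((y \<bullet> Y) * (Y1 y \<bullet> Z) - (y \<bullet> Z) * (Y1 y \<bullet> Y))
    + (y \<bullet> y) * ((Y2 y \<bullet> Y) * (Y3 y \<bullet> Z) - (Y2 y \<bullet> Z) * (Y3 y \<bullet> Y))"
proof -
  have R: "y \<bullet> y \<noteq> 0"
    using assms by simp
  have "((\<lambda>x. x \<bullet> x) has_derivative (\<lambda>X. 2 * (y \<bullet> X))) (at y)"
    by (rule has_derivative_eq_rhs, rule has_derivative_inner, (rule has_derivative_ident)+)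
      (simp add: fun_eq_iff inner_commute)
  moreover have "((\<lambda>x. Y1 x \<bullet> Z) has_derivative (\<lambda>X. Y1 X \<bullet> Z)) (at y)" for Z
    using bounded_linear.has_derivative[OF bounded_linear_Y(1) has_derivative_ident]
    by (rule has_derivative_inner_left)
  ultimately have "((\<lambda>x. (Y1 x \<bullet> Z) / (x \<bullet> x)) has_derivative
      (\<lambda>X. ((Y1 X \<bullet> Z) * (y \<bullet> y) - (Y1 y \<bullet> Z) * (2 * (y \<bullet> X))) / ((y \<bullet> y) * (y \<bullet> y)))) (at y)" for Z
    using R by (intro has_derivative_divide')
  then have fd: "frechet_derivative (\<lambda>x. (Y1 x \<bullet> Z) / (x \<bullet> x)) (at y) =
     (\<lambda>X. ((Y1 X \<bullet> Z) * (y \<bullet> y) - (Y1 y \<bullet> Z) * (2 * (y \<bullet> X))) / ((y \<bullet> y) * (y \<bullet> y)))" for Z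
    by (rule frechet_derivative_at[symmetric])
  have "(a * r - p * (2 * c)) / (r * r) - (- a * r - q * (2 * d)) / (r * r)
      = 2 * a / r - 2 * (c * p - d * q) / r\<^sup>2" if "r \<noteq> 0" for a r p c q d :: real
    using that by (simp add: field_simps power2_eq_square)
  from this[OF R] have ed: "ext_deriv1 (alpha_hat Y1) y Y Z =
      2 * (Y1 Y \<bullet> Z) / (y \<bullet> y) - 2 * ((y \<bullet> Y) * (Y1 y \<bullet> Z) - (y \<bullet> Z) * (Y1 y \<bullet> Y)) / (y \<bullet> y)\<^sup>2"
    unfolding ext_deriv1_def alpha_hat_def Rsq_inner e_metric_inner fd Y1_skew[of Z Y] .
  have identity: "1 / 3 * r ^ 3 * (2 * a / r - 2 * b / r\<^sup>2 + 3 * (c / r * (d / r) - e / r * (f / r)))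
    = 2 / 3 * r\<^sup>2 * a - 2 / 3 * r * b + r * (c * d - e * f)" if "r \<noteq> 0" for r a b c d e f :: real
  proof -
    have 1: "2 * a / r - 2 * b / r\<^sup>2 + 3 * (c / r * (d / r) - e / r * (f / r))
      = (2 * a * r - 2 * b + 3 * (c * d - e * f)) / r\<^sup>2"
      using that by (simp add: divide_simps power2_eq_square)
    have 2: "1 / 3 * r ^ 3 * (x / r\<^sup>2) = 1 / 3 * r * x" for x
      using that by (simp add: power2_eq_square power3_eq_cube)
    show ?thesis
      unfolding 1 2 by (simp add: algebra_simps power2_eq_square)
  qed
  show ?thesis
    unfolding omega_def wedge_def ed unfolding alpha_hat_def Rsq_inner e_metric_inner
    by (rule identity[OF R])
qed

lemma varphi_eq:
  assumes "x \<noteq> 0"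
  shows "varphi x X Y Z = 2 * phi_half (cz x) (cz X) (cz Y) (cz Z)"
proof -
  define k :: real where "k = 2/3"
  define P where "P y Y Z = 
    k * (y \<bullet> y)\<^sup>2 * (Y1 Y \<bullet> Z) - k * (y \<bullet> y) * ((y \<bullet> Y) * (Y1 y \<bullet> Z) - (y \<bullet> Z) * (Y1 y \<bullet> Y))
    + (y \<bullet> y) * ((Y2 y \<bullet> Y) * (Y3 y \<bullet> Z) - (Y2 y \<bullet> Z) * (Y3 y \<bullet> Y))" for y Y Z
  define P' where "P' X Y Z = 
    4 * k * (x \<bullet> x) * (x \<bullet> X) * (Y1 Y \<bullet> Z) - 2 * k * (x \<bullet> X) * ((x \<bullet> Y) * (Y1 x \<bullet> Z) - (x \<bullet> Z) * (Y1 x \<bullet> Y))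
    - k * (x \<bullet> x) * ((X \<bullet> Y) * (Y1 x \<bullet> Z) - (X \<bullet> Z) * (Y1 x \<bullet> Y) + (x \<bullet> Y) * (Y1 X \<bullet> Z) - (x \<bullet> Z) * (Y1 X \<bullet> Y))
    + 2 * (x \<bullet> X) * ((Y2 x \<bullet> Y) * (Y3 x \<bullet> Z) - (Y2 x \<bullet> Z) * (Y3 x \<bullet> Y))
    + (x \<bullet> x) * ((Y2 X \<bullet> Y) * (Y3 x \<bullet> Z) - (Y2 X \<bullet> Z) * (Y3 x \<bullet> Y) + (Y2 x \<bullet> Y) * (Y3 X \<bullet> Z) - (Y2 x \<bullet> Z) * (Y3 X \<bullet> Y))"
    for X Y Z
  have d1: "((\<lambda>y. y \<bullet> y) has_derivative (\<lambda>X. 2 * (x \<bullet> X))) (at x)"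
    by (rule has_derivative_eq_rhs, rule has_derivative_inner, (rule has_derivative_ident)+)
      (simp add: fun_eq_iff inner_commute)
  have d2: "((\<lambda>y. y \<bullet> W) has_derivative (\<lambda>X. X \<bullet> W)) (at x)"
    "((\<lambda>y. Y1 y \<bullet> W) has_derivative (\<lambda>X. Y1 X \<bullet> W)) (at x)"
    "((\<lambda>y. Y2 y \<bullet> W) has_derivative (\<lambda>X. Y2 X \<bullet> W)) (at x)"
    "((\<lambda>y. Y3 y \<bullet> W) has_derivative (\<lambda>X. Y3 X \<bullet> W)) (at x)" for W
    by (intro has_derivative_inner_left bounded_linear_Y[THEN bounded_linear.has_derivative]
          has_derivative_ident)+
  have "((\<lambda>y. P y Y Z) has_derivative (\<lambda>X. P' X Y Z)) (at x)" for Y Z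
    unfolding P_def power2_eq_square
    by (rule has_derivative_eq_rhs, (rule has_derivative_add has_derivative_diff has_derivative_mult
          has_derivative_const d1 d2)+)
      (simp add: P'_def fun_eq_iff algebra_simps)
  \<comment> \<open>The polynomial expression is available off the origin, so the derivative is
    transferred on that open set.\<close>
  then have "((\<lambda>y. 1/3 * (Rsq y)^3 * omega y Y Z) has_derivative (\<lambda>X. P' X Y Z)) (at x)" for Y Z
    by (rule has_derivative_transform_within_open[OF _ open_Compl[OF closed_singleton[of 0]]])
      (use assms omega_eq in \<open>simp_all add: P_def k_def\<close>)
  then have "frechet_derivative (\<lambda>y. 1/3 * (Rsq y)^3 * omega y Y Z) (at x) = (\<lambda>X. P' X Y Z)" for Y Z
    by (rule frechet_derivative_at[symmetric])
  then have *: "varphi x X Y Z = P' X Y Z - P' Y X Z + P' Z X Y"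
    unfolding varphi_def ext_deriv2_def by simp
  have h: "csymp a b = - csymp b a" "herm b a = cnj (herm a b)" for a b
    by (cases a; cases b; simp)+
  show ?thesis
    unfolding * P'_def phi_half_def phi_half1_def inner_cz(2-4) unfolding inner_cz(1)
      h(1)[of "cz Y" "cz X"] h(1)[of "cz Z" "cz X"] h(1)[of "cz Z" "cz Y"] 
      h(2)[of "cz Y" "cz X"] h(2)[of "cz Z" "cz X"] h(2)[of "cz Z" "cz Y"] 
      h(2)[of "cz X" "cz x"] h(2)[of "cz Y" "cz x"] h(2)[of "cz Z" "cz x"] 
    by (simp add: k_def algebra_simps)
qed

section \<open>Tangent vectors of level sets\<close>

lemma tangent_space_imp_derivative_eq_0:
  assumes v: "v \<in> tangent_space S x"
    and g: "(g has_derivative g') (at x)" and const: "\<And>y. y \<in> S \<Longrightarrow> g y = c"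
  shows "g' v = 0"
proof -
  obtain e and \<gamma> :: "real \<Rightarrow> 'a" where e: "e > 0" "\<gamma> ` {-e<..<e} \<subseteq> S" "\<gamma> 0 = x"
    "(\<gamma> has_derivative (\<lambda>h. h *\<^sub>R v)) (at 0)"
    using v unfolding tangent_space_def has_vector_derivative_def by auto
  have "((\<lambda>h. g (\<gamma> h)) has_derivative (\<lambda>h. g' (h *\<^sub>R v))) (at 0)"
    using g by (intro has_derivative_compose[OF e(4)]) (simp add: e(3))
  moreover have "((\<lambda>h. g (\<gamma> h)) has_derivative (\<lambda>h. 0)) (at 0)"
  proof (rule has_derivative_transform_within_open)
    show "((\<lambda>h. c) has_derivative (\<lambda>h. 0)) (at 0)" "open {-e<..<e}" "0 \<in> {-e<..<e}"
      using e(1) by simp_all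
    show "c = g (\<gamma> h)" if "h \<in> {-e<..<e}" for h
      using that e(2) const by (metis image_subset_iff)
  qed
  ultimately have "(\<lambda>h. g' (h *\<^sub>R v)) = (\<lambda>h. 0)"
    by (rule has_derivative_unique)
  from fun_cong[OF this, of 1] show ?thesis
    by simp
qed

lemma bounded_linear_z: "bounded_linear z0" "bounded_linear z1" "bounded_linear z2" "bounded_linear z3"
  unfolding linear_conv_bounded_linear[symmetric]
  by (rule linearI; simp add: z0_def z1_def z2_def z3_def complex_eq_iff)+

lemmas z_has_derivative = bounded_linear_z[THEN bounded_linear.has_derivative, OF has_derivative_ident]

lemma f_plus_has_derivative: "(f_plus has_derivative (\<lambda>X. mix (cz x) (cz X))) (at x)"
  unfolding f_plus_def[abs_def]
  by (rule has_derivative_eq_rhs, (rule has_derivative_diff has_derivative_mult has_derivative_cnj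
        z_has_derivative)+)
    (simp add: cz_def fun_eq_iff algebra_simps)

lemma cmod_squared_has_derivative:
  assumes "(f has_derivative f') (at x)"
  shows "((\<lambda>x. (cmod (f x))\<^sup>2) has_derivative (\<lambda>X. 2 * Re (cnj (f x) * f' X))) (at x)"
  unfolding power2_norm_eq_inner
  by (rule has_derivative_eq_rhs, rule has_derivative_inner, (rule assms)+)
    (simp add: fun_eq_iff inner_complex_def algebra_simps)

lemma b_fun_has_derivative: "(b_fun has_derivative (\<lambda>X. 4 * db4 (cz x) (cz X))) (at x)"
  unfolding b_fun_def[abs_def] u_fun_def v_fun_def
  by (rule has_derivative_eq_rhs, (rule has_derivative_diff has_derivative_add
        cmod_squared_has_derivative has_derivative_power z_has_derivative)+)
    (simp add: cz_def fun_eq_iff cmod_power2, simp add: algebra_simps power2_eq_square)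

text \<open>Tangent vectors of the preimage annihilate df and db, and \<open>phi_half_eq_0\<close>
  applies to any three of them.\<close>

lemma varphi_vanishes_on_level_set:
  assumes "\<And>x. x \<in> preim W \<Longrightarrow> f_plus x = c" "\<And>x. x \<in> preim W \<Longrightarrow> b_fun x = b"
  shows "varphi_vanishes_on W"
  unfolding varphi_vanishes_on_def
proof (intro ballI)
  fix x X Y Z
  assume x: "x \<in> preim W" and tangent: "X \<in> tangent_space (preim W) x"
    "Y \<in> tangent_space (preim W) x" "Z \<in> tangent_space (preim W) x"
  have "x \<noteq> 0"
    using x by (simp add: preim_def)
  then have "Re (herm (cz x) (cz x)) \<noteq> 0"
    by (simp add: inner_cz(1)[symmetric])
  then have "cz x \<noteq> (0, 0, 0, 0)"
    by auto
  moreover have "mix (cz x) (cz V) = 0" "db4 (cz x) (cz V) = 0" if "V \<in> tangent_space (preim W) x" for V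
    using tangent_space_imp_derivative_eq_0[OF that f_plus_has_derivative] assms(1)
      tangent_space_imp_derivative_eq_0[OF that b_fun_has_derivative] assms(2) by auto
  ultimately show "varphi x X Y Z = 0"
    using tangent varphi_eq[OF \<open>x \<noteq> 0\<close>] phi_half_eq_0 by simp
qed

section \<open>Charts of the cone\<close>

lemma smooth_on_cmod_power2 [smooth_intros]:
  "open S \<Longrightarrow> smooth_on S f \<Longrightarrow> smooth_on S (\<lambda>x. (cmod (f x))\<^sup>2)"
  unfolding power2_norm_eq_inner by (intro smooth_intros)

definition zeta :: "complex \<Rightarrow> complex \<Rightarrow> complex" where
  "zeta a1 a2 = a2 / a1"

text \<open>Under a common rotation of the entries the conjugate determinant has weight -2, which
  \<open>a1\<^sup>2\<close> compensates. The denominator makes \<open>|k| (1 + |z|^2)\<close> the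
  modulus of the determinant.\<close>

definition kappa :: "complex \<Rightarrow> complex \<Rightarrow> complex \<Rightarrow> complex \<Rightarrow> complex" where
  "kappa a1 a2 a3 a4 = a1\<^sup>2 * cnj (a1 * a4 - a2 * a3) / of_real ((cmod a1)\<^sup>2 + (cmod a2)\<^sup>2)"

definition pairing :: "complex \<Rightarrow> complex \<Rightarrow> complex \<Rightarrow> complex \<Rightarrow> complex" where
  "pairing a1 a2 a3 a4 = a1 * cnj a3 + a2 * cnj a4"

definition quartic :: "complex \<Rightarrow> complex \<Rightarrow> complex \<Rightarrow> complex \<Rightarrow> real" where
  "quartic a1 a2 a3 a4 = ((cmod a1)\<^sup>2 + (cmod a2)\<^sup>2)\<^sup>2 - ((cmod a3)\<^sup>2 + (cmod a4)\<^sup>2)\<^sup>2"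

text \<open>\<open>usol\<close> is the solution \<open>u\<close> of \<open>u\<^sup>2 - (E/u)\<^sup>2 = b\<close> with \<open>E = |f|\<^sup>2 + |D|\<^sup>2 = u v\<close> and
  \<open>|D| = |k| (1 + |z|\<^sup>2)\<close>; \<open>lift\<close> is the point with the given coordinates whose first entry is
  positive.\<close>

definition usol :: "complex \<Rightarrow> complex \<Rightarrow> complex \<Rightarrow> real \<Rightarrow> real" where
  "usol z k f b = sqrt ((b + sqrt (b\<^sup>2 + 4 * ((cmod f)\<^sup>2 + (cmod k)\<^sup>2 * (1 + (cmod z)\<^sup>2)\<^sup>2)\<^sup>2)) / 2)"

definition rho :: "complex \<Rightarrow> complex \<Rightarrow> complex \<Rightarrow> real \<Rightarrow> real" where
  "rho z k f b = sqrt (usol z k f b / (1 + (cmod z)\<^sup>2))"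

definition lift :: "complex \<Rightarrow> complex \<Rightarrow> complex \<Rightarrow> real \<Rightarrow> c4" where
  "lift z k f b = (let u = of_real (usol z k f b); r = of_real (rho z k f b); n = 1 + of_real ((cmod z)\<^sup>2)
     in (r, r * z, r * (cnj f - cnj (k * n) * cnj z) / u, r * (cnj f * z + cnj (k * n)) / u))"

text \<open>Exactly the parameters with positive \<open>usol\<close>: for b <= 0 and f = k = 0 the
  outer radicand is 0.\<close>

definition admissible :: "complex \<Rightarrow> complex \<Rightarrow> real \<Rightarrow> bool" where
  "admissible k f b \<longleftrightarrow> b > 0 \<or> f \<noteq> 0 \<or> k \<noteq> 0"

lemma lagrange_identity:
  "((cmod a1)\<^sup>2 + (cmod a2)\<^sup>2) * ((cmod a3)\<^sup>2 + (cmod a4)\<^sup>2) =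
    (cmod (pairing a1 a2 a3 a4))\<^sup>2 + (cmod (a1 * a4 - a2 * a3))\<^sup>2"
  by (simp add: pairing_def cmod_power2) (simp add: algebra_simps power2_eq_square)

lemma one_plus_square_pos: "1 + (cmod z)\<^sup>2 > 0"
  by (simp add: add_pos_nonneg)

text \<open>The radicands of the two roots in \<open>usol\<close>; smoothness of both roots needs
  both to be positive.\<close>

lemma admissible_sqrt_pos:
  fixes z :: complex
  assumes "admissible k f b"
  defines "E \<equiv> (cmod f)\<^sup>2 + (cmod k)\<^sup>2 * (1 + (cmod z)\<^sup>2)\<^sup>2"
  shows "b\<^sup>2 + 4 * E\<^sup>2 > 0" "b + sqrt (b\<^sup>2 + 4 * E\<^sup>2) > 0"
proof -
  have n: "1 + (cmod z)\<^sup>2 > 0"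
    by (rule one_plus_square_pos)
  have "E > 0" if "f \<noteq> 0"
    unfolding E_def using that by (intro add_pos_nonneg) auto
  moreover have "E > 0" if "k \<noteq> 0"
    unfolding E_def using that n by (intro add_nonneg_pos) auto
  ultimately have "b > 0 \<or> E > 0"
    using assms(1) by (auto simp: admissible_def)
  then show "b\<^sup>2 + 4 * E\<^sup>2 > 0"
    by (elim disjE) (simp_all add: add_pos_nonneg add_nonneg_pos)
  show "b + sqrt (b\<^sup>2 + 4 * E\<^sup>2) > 0"
  proof (cases "b > 0")
    case False
    with \<open>b > 0 \<or> E > 0\<close> have "E > 0"
      by simp
    then have "sqrt (b\<^sup>2) < sqrt (b\<^sup>2 + 4 * E\<^sup>2)"
      by (intro real_sqrt_less_mono) simp
    then show ?thesis
      by simp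
  qed (simp add: add_pos_nonneg)
qed

lemma usol_pos: "admissible k f b \<Longrightarrow> usol z k f b > 0"
  using admissible_sqrt_pos(2) by (simp add: usol_def)

lemma rho_pos: "admissible k f b \<Longrightarrow> rho z k f b > 0"
  using usol_pos one_plus_square_pos by (simp add: rho_def)

lemma usol_equation:
  fixes z :: complex
  assumes "admissible k f b"
  defines "E \<equiv> (cmod f)\<^sup>2 + (cmod k)\<^sup>2 * (1 + (cmod z)\<^sup>2)\<^sup>2" and "u \<equiv> usol z k f b"
  shows "u\<^sup>2 - (E / u)\<^sup>2 = b"
proof -
  have u: "u > 0"
    unfolding u_def using assms(1) by (rule usol_pos)
  have "u\<^sup>2 = (b + sqrt (b\<^sup>2 + 4 * E\<^sup>2)) / 2"
    using admissible_sqrt_pos(2)[OF assms(1), of z] by (simp add: u_def usol_def E_def)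
  then have "2 * u\<^sup>2 - b = sqrt (b\<^sup>2 + 4 * E\<^sup>2)"
    by simp
  then have "(2 * u\<^sup>2 - b)\<^sup>2 = b\<^sup>2 + 4 * E\<^sup>2"
    by (simp only:) simp
  then have "u\<^sup>2 * u\<^sup>2 - E\<^sup>2 = b * u\<^sup>2"
    by (simp add: power2_eq_square algebra_simps)
  then have "(u\<^sup>2 - b) * u\<^sup>2 = E\<^sup>2"
    by (simp add: algebra_simps)
  then have "u\<^sup>2 - b = E\<^sup>2 / u\<^sup>2"
    using u by (simp add: eq_divide_eq)
  then show ?thesis
    by (simp add: power_divide)
qed

lemma lift_coordinates:
  assumes adm: "admissible k f b" and a: "lift z k f b = (a1, a2, a3, a4)"
  shows "a1 \<noteq> 0" "zeta a1 a2 = z" "kappa a1 a2 a3 a4 = k" "pairing a1 a2 a3 a4 = f"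
    "quartic a1 a2 a3 a4 = b"
proof -
  define u r n where "u = usol z k f b" and "r = rho z k f b" and "n = 1 + (cmod z)\<^sup>2"
  have pos: "u > 0" "r > 0" "n > 0"
    using adm usol_pos rho_pos one_plus_square_pos by (auto simp: u_def r_def n_def)
  \<comment> \<open>The left side is the squared length of the \<open>w\<close> part of the lift.
    The claims on \<open>kappa\<close> and \<open>pairing\<close> below amount to cancelling this
    factor against \<open>u\<close>.\<close>
  have rn: "r\<^sup>2 * n = u"
    using pos by (simp add: r_def rho_def u_def[symmetric] n_def[symmetric])
  have a_eq: "a1 = of_real r" "a2 = of_real r * z" "a3 = of_real r * (cnj f - cnj (k * of_real n) * cnj z) / of_real u"
    "a4 = of_real r * (cnj f * z + cnj (k * of_real n)) / of_real u"
    using a by (auto simp: lift_def Let_def u_def r_def n_def)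
  have nz: "of_real n = 1 + z * cnj z"
    by (simp add: n_def complex_norm_square[symmetric])
  have rnc: "complex_of_real r * of_real r * of_real n = of_real u"
    unfolding rn[symmetric] by (simp add: power2_eq_square)
  show "a1 \<noteq> 0" "zeta a1 a2 = z"
    using pos by (auto simp: a_eq zeta_def)
  have uu: "(cmod a1)\<^sup>2 + (cmod a2)\<^sup>2 = u"
    using pos by (simp add: a_eq norm_mult rn[symmetric] power_mult_distrib n_def algebra_simps)
  have "a1 * a4 - a2 * a3 = (of_real r * of_real r * of_real n) * cnj (k * of_real n) / of_real u"
    unfolding a_eq nz by (simp add: algebra_simps diff_divide_distrib add_divide_distrib)
  then have det: "a1 * a4 - a2 * a3 = cnj (k * of_real n)"
    unfolding rnc using pos by simp
  have "pairing a1 a2 a3 a4 = (of_real r * of_real r * of_real n) * f / of_real u"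
    unfolding a_eq nz pairing_def by (simp add: algebra_simps diff_divide_distrib add_divide_distrib)
  then show p: "pairing a1 a2 a3 a4 = f"
    unfolding rnc using pos by simp
  have "kappa a1 a2 a3 a4 = (of_real r * of_real r * of_real n) * k / of_real u"
    unfolding kappa_def det uu by (simp add: a_eq power2_eq_square)
  then show "kappa a1 a2 a3 a4 = k"
    unfolding rnc using pos by simp
  have "u * ((cmod a3)\<^sup>2 + (cmod a4)\<^sup>2) = (cmod f)\<^sup>2 + (cmod k)\<^sup>2 * n\<^sup>2"
    using lagrange_identity[of a1 a2 a3 a4] pos unfolding uu p det
    by (simp add: norm_mult power_mult_distrib)
  then have "(cmod a3)\<^sup>2 + (cmod a4)\<^sup>2 = ((cmod f)\<^sup>2 + (cmod k)\<^sup>2 * n\<^sup>2) / u"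
    using pos by (simp add: field_simps)
  then show "quartic a1 a2 a3 a4 = b"
    using usol_equation[OF adm, of z] unfolding quartic_def uu by (simp add: u_def n_def)
qed

text \<open>If the pairing and \<open>kappa\<close> vanish, Lagrange's identity forces
  \<open>w' = 0\<close>, and then \<open>quartic\<close> is the positive number |w|^4.\<close>

lemma coordinates_admissible:
  assumes "a1 \<noteq> 0"
  shows "admissible (kappa a1 a2 a3 a4) (pairing a1 a2 a3 a4) (quartic a1 a2 a3 a4)"
proof (rule ccontr)
  assume *: "\<not> ?thesis"
  let ?u = "(cmod a1)\<^sup>2 + (cmod a2)\<^sup>2"
  have u: "?u > 0"
    using assms by (simp add: add_pos_nonneg)
  then have "complex_of_real ?u \<noteq> 0"
    by (metis less_irrefl of_real_eq_0_iff)
  then have "a1 * a4 - a2 * a3 = 0" "pairing a1 a2 a3 a4 = 0"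
    using * assms by (auto simp: admissible_def kappa_def simp del: of_real_add complex_cnj_diff complex_cnj_mult)
  then have "(cmod a3)\<^sup>2 + (cmod a4)\<^sup>2 = 0"
    using lagrange_identity[of a1 a2 a3 a4] u by auto
  then have "quartic a1 a2 a3 a4 > 0"
    using assms by (simp add: quartic_def)
  with * show False
    by (simp add: admissible_def)
qed

lemma lift_of_coordinates:
  assumes r: "r > 0" and a1: "a1 = of_real r"
  shows "lift (zeta a1 a2) (kappa a1 a2 a3 a4) (pairing a1 a2 a3 a4) (quartic a1 a2 a3 a4) = (a1, a2, a3, a4)"
proof -
  define z k f b where "z = zeta a1 a2" and "k = kappa a1 a2 a3 a4" and "f = pairing a1 a2 a3 a4"
    and "b = quartic a1 a2 a3 a4"
  define u v n where "u = (cmod a1)\<^sup>2 + (cmod a2)\<^sup>2" and "v = (cmod a3)\<^sup>2 + (cmod a4)\<^sup>2"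
    and "n = 1 + (cmod z)\<^sup>2"
  have u: "u > 0" and v: "v \<ge> 0" and n: "n > 0"
    using r a1 one_plus_square_pos by (auto simp: u_def v_def n_def add_pos_nonneg)
  have a2: "a2 = of_real r * z"
    using r by (simp add: z_def zeta_def a1)
  have un: "u = r\<^sup>2 * n"
    using r unfolding u_def n_def a2 a1 by (simp add: norm_mult power_mult_distrib algebra_simps)
  have "k = of_real (r\<^sup>2) * cnj (a1 * a4 - a2 * a3) / of_real (r\<^sup>2 * n)"
    unfolding k_def kappa_def u_def[symmetric] un[symmetric] by (simp add: a1)
  then have kn: "k * of_real n = cnj (a1 * a4 - a2 * a3)"
    using r n by simp
  have "cmod k * n = cmod (a1 * a4 - a2 * a3)"
    using arg_cong[OF kn, of cmod] n by (simp add: norm_mult del: complex_cnj_diff complex_cnj_mult)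
  then have E: "(cmod f)\<^sup>2 + (cmod k)\<^sup>2 * n\<^sup>2 = u * v"
    unfolding u_def v_def lagrange_identity f_def by (metis power_mult_distrib)
  \<comment> \<open>With b = u^2 - v^2 the discriminant is a perfect square, so the formula for
    \<open>usol\<close> returns \<open>u\<close>.\<close>
  have "b\<^sup>2 + 4 * (u * v)\<^sup>2 = (u\<^sup>2 + v\<^sup>2)\<^sup>2"
    unfolding b_def quartic_def u_def[symmetric] v_def[symmetric]
    by (simp add: power2_eq_square algebra_simps)
  then have "sqrt (b\<^sup>2 + 4 * (u * v)\<^sup>2) = u\<^sup>2 + v\<^sup>2"
    by simp
  then have us: "usol z k f b = u"
    unfolding usol_def n_def[symmetric] E using u
    by (simp add: b_def quartic_def u_def[symmetric] v_def[symmetric])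
  have rho: "rho z k f b = r"
    unfolding rho_def us n_def[symmetric] un using n r by simp
  have "r * (cnj f - cnj (k * of_real n) * cnj z) = a3 * of_real u"
    "r * (cnj f * z + cnj (k * of_real n)) = a4 * of_real u"
  proof -
    have "of_real u = complex_of_real r * of_real r * (1 + z * cnj z)"
      unfolding un n_def by (simp add: complex_norm_square[symmetric] power2_eq_square)
    then show "r * (cnj f - cnj (k * of_real n) * cnj z) = a3 * of_real u"
      "r * (cnj f * z + cnj (k * of_real n)) = a4 * of_real u"
      unfolding kn f_def pairing_def a2 a1 by (simp_all add: algebra_simps)
  qed
  then show ?thesis
    using u unfolding z_def[symmetric] k_def[symmetric] f_def[symmetric] b_def[symmetric]
    unfolding lift_def Let_def us rho
    by (simp add: n_def a1 a2)
qed

lemma coordinates_rotate: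
  assumes "cmod c = 1" 
  shows "zeta (c * a1) (c * a2) = zeta a1 a2"
    "kappa (c * a1) (c * a2) (c * a3) (c * a4) = kappa a1 a2 a3 a4"
    "pairing (c * a1) (c * a2) (c * a3) (c * a4) = pairing a1 a2 a3 a4"
    "quartic (c * a1) (c * a2) (c * a3) (c * a4) = quartic a1 a2 a3 a4"
proof -
  have c: "c * cnj c = 1" "c \<noteq> 0"
    using assms complex_norm_square[of c] by auto
  show "zeta (c * a1) (c * a2) = zeta a1 a2"
    using c by (simp add: zeta_def)
  have "(c * a1)\<^sup>2 * cnj ((c * a1) * (c * a4) - (c * a2) * (c * a3)) =
     (c * cnj c)\<^sup>2 * (a1\<^sup>2 * cnj (a1 * a4 - a2 * a3))"
    by (simp add: algebra_simps power2_eq_square)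
  then show "kappa (c * a1) (c * a2) (c * a3) (c * a4) = kappa a1 a2 a3 a4"
    unfolding kappa_def c by (simp add: norm_mult assms)
  have "pairing (c * a1) (c * a2) (c * a3) (c * a4) = (c * cnj c) * pairing a1 a2 a3 a4"
    by (simp add: pairing_def algebra_simps)
  then show "pairing (c * a1) (c * a2) (c * a3) (c * a4) = pairing a1 a2 a3 a4"
    by (simp add: c)
  show "quartic (c * a1) (c * a2) (c * a3) (c * a4) = quartic a1 a2 a3 a4"
    by (simp add: quartic_def norm_mult assms)
qed

section \<open>Packing coordinates into real vectors\<close>

definition enc2 :: "real \<Rightarrow> real \<Rightarrow> real^2" where
  "enc2 s t = s *\<^sub>R axis 1 1 + t *\<^sub>R axis 2 1"

definition enc3 :: "complex \<Rightarrow> real \<Rightarrow> real^3" where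
  "enc3 f b = Re f *\<^sub>R axis 1 1 + Im f *\<^sub>R axis 2 1 + b *\<^sub>R axis 3 1"

definition enc4 :: "complex \<Rightarrow> complex \<Rightarrow> real^4" where
  "enc4 z k = Re z *\<^sub>R axis 1 1 + Im z *\<^sub>R axis 2 1 + Re k *\<^sub>R axis 3 1 + Im k *\<^sub>R axis 4 1"

lemma enc_nth:
  "enc2 s t $ 1 = s" "enc2 s t $ 2 = t"
  "Complex (enc3 f b $ 1) (enc3 f b $ 2) = f" "enc3 f b $ 3 = b"
  "Complex (enc4 z k $ 1) (enc4 z k $ 2) = z" "Complex (enc4 z k $ 3) (enc4 z k $ 4) = k"
  by (simp_all add: enc2_def enc3_def enc4_def axis_def)

lemma enc_surj:
  "enc2 (y2 $ 1) (y2 $ 2) = y2"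
  "enc3 (Complex (y3 $ 1) (y3 $ 2)) (y3 $ 3) = y3"
  "enc4 (Complex (y4 $ 1) (y4 $ 2)) (Complex (y4 $ 3) (y4 $ 4)) = y4"
  by (simp_all add: enc2_def enc3_def enc4_def axis_def vec_eq_iff forall_2 forall_3 forall_4)

lemma enc_inject:
  "enc2 s t = enc2 s' t' \<longleftrightarrow> s = s' \<and> t = t'"
  "enc3 f b = enc3 f' b' \<longleftrightarrow> f = f' \<and> b = b'"
  "enc4 z k = enc4 z' k' \<longleftrightarrow> z = z' \<and> k = k'"
  by (metis enc_nth)+

lemma enc_eq_0_iff: "enc2 s t = 0 \<longleftrightarrow> s = 0 \<and> t = 0" "enc3 f b = 0 \<longleftrightarrow> f = 0 \<and> b = 0"
  using enc_inject(1)[of s t 0 0] enc_inject(2)[of f b 0 0] by (simp_all add: enc2_def enc3_def)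

lemma smooth_on_enc [smooth_intros]:
  "open S \<Longrightarrow> smooth_on S s \<Longrightarrow> smooth_on S t \<Longrightarrow> smooth_on S (\<lambda>x. enc2 (s x) (t x))"
  "open S \<Longrightarrow> smooth_on S f \<Longrightarrow> smooth_on S s \<Longrightarrow> smooth_on S (\<lambda>x. enc3 (f x) (s x))"
  "open S \<Longrightarrow> smooth_on S f \<Longrightarrow> smooth_on S g \<Longrightarrow> smooth_on S (\<lambda>x. enc4 (f x) (g x))"
  unfolding enc2_def enc3_def enc4_def by (intro smooth_intros; assumption)+

section \<open>Orbits of the circle action and functions on them\<close>

lemma flow_add: "flow \<sigma> (flow \<tau> x) = flow (\<sigma> + \<tau>) x"
  by (simp add: vec_eq_iff forall_8 flow_def Y1_nth cos_add sin_add algebra_simps)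

lemma self_in_proj: "x \<in> proj x"
  unfolding proj_def by (metis flow_0 rangeI)

lemma proj_eq_iff: "proj x = proj y \<longleftrightarrow> (\<exists>\<tau>. y = flow \<tau> x)"
proof
  assume "proj x = proj y"
  then show "\<exists>\<tau>. y = flow \<tau> x"
    using self_in_proj[of y] by (auto simp: proj_def)
next
  assume "\<exists>\<tau>. y = flow \<tau> x"
  then obtain \<tau> where y: "y = flow \<tau> x"
    by blast
  have "flow \<sigma> x = flow (\<sigma> - \<tau>) y" "flow \<sigma> y = flow (\<sigma> + \<tau>) x" for \<sigma>
    by (simp_all add: y flow_add)
  then show "proj x = proj y"
    unfolding proj_def by blast
qed

text \<open>Evaluation at a chosen point of the orbit; the choice is immaterial once
  \<open>g\<close> is invariant under the flow.\<close>

definition descend :: "(real^8 \<Rightarrow> 'b) \<Rightarrow> (real^8) set \<Rightarrow> 'b" where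
  "descend g p = g (SOME x. x \<in> p)"

lemma descend_proj:
  assumes "\<And>\<tau> x. g (flow \<tau> x) = g x"
  shows "descend g (proj x) = g x"
proof -
  have "(SOME y. y \<in> proj x) \<in> proj x"
    using self_in_proj by (rule someI)
  then show ?thesis
    using assms by (auto simp: descend_def proj_def)
qed

lemma bounded_linear_flow: "bounded_linear (flow \<tau>)"
  unfolding flow_def[abs_def]
  by (intro bounded_linear_add bounded_linear_scaleR_right bounded_linear_const_scaleR
        bounded_linear_Y bounded_linear_ident)

text \<open>\<open>zeta\<close> is an affine coordinate on the sphere of lines in \<open>\<complex>\<^sup>2\<close> and \<open>kappa\<close> a fibre coordinate.
  Permuting the entries of \<open>cz\<close> turns one chart into an atlas of the cone.\<close>

locale frame =
  fixes C1 C2 C3 C4 :: "real^8 \<Rightarrow> complex" and C' :: "c4 \<Rightarrow> real^8"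
  assumes bl: "bounded_linear C1" "bounded_linear C2" "bounded_linear C3" "bounded_linear C4"
    and bl': "bounded_linear C'"
    and rot: "C1 (flow \<tau> x) = cis \<tau> * C1 x" "C2 (flow \<tau> x) = cis \<tau> * C2 x"
      "C3 (flow \<tau> x) = cis \<tau> * C3 x" "C4 (flow \<tau> x) = cis \<tau> * C4 x"
    and CC': "C1 (C' (a1, a2, a3, a4)) = a1" "C2 (C' (a1, a2, a3, a4)) = a2"
      "C3 (C' (a1, a2, a3, a4)) = a3" "C4 (C' (a1, a2, a3, a4)) = a4"
    and C'C: "C' (C1 x, C2 x, C3 x, C4 x) = x"
begin

definition "zC x = zeta (C1 x) (C2 x)"
definition "kC x = kappa (C1 x) (C2 x) (C3 x) (C4 x)"
definition "fC x = pairing (C1 x) (C2 x) (C3 x) (C4 x)"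
definition "bC x = quartic (C1 x) (C2 x) (C3 x) (C4 x)"

text \<open>The shifts by \<open>c\<close> and \<open>b\<close> put the corresponding level set on
  the slice where the second component vanishes.\<close>

definition chart_fun :: "complex \<Rightarrow> real \<Rightarrow> real^8 \<Rightarrow> (real^4) \<times> (real^3)" where
  "chart_fun c b x = (enc4 (zC x) (kC x), enc3 (fC x - c) (bC x - b))"

definition chart_dom :: "(real^8) set set" where
  "chart_dom = {proj x | x. C1 x \<noteq> 0}"

lemma coords_flow: "zC (flow \<tau> x) = zC x" "kC (flow \<tau> x) = kC x" "fC (flow \<tau> x) = fC x"
  "bC (flow \<tau> x) = bC x"
  by (simp_all add: zC_def kC_def fC_def bC_def rot coordinates_rotate)

lemma chart_fun_flow: "chart_fun c b (flow \<tau> x) = chart_fun c b x"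
  by (simp add: chart_fun_def coords_flow)

lemma descend_chart_fun: "descend (chart_fun c b) (proj x) = chart_fun c b x"
  by (rule descend_proj) (rule chart_fun_flow)

lemma C1_0: "C1 0 = 0"
  using bl(1) by (rule linear_simps)

lemma preim_chart_dom: "preim chart_dom = {x. C1 x \<noteq> 0}"
proof -
  have "C1 x \<noteq> 0" if "proj x = proj y" "C1 y \<noteq> 0" for x y
    using that unfolding proj_eq_iff by (auto simp: rot)
  then show ?thesis
    using C1_0 unfolding preim_def chart_dom_def by auto
qed

lemma open_C1: "open {x. C1 x \<noteq> 0}"
  by (intro open_Collect_neq continuous_on_const linear_continuous_on bl)

lemma smooth_coords:
  "smooth_on {x. C1 x \<noteq> 0} zC" "smooth_on {x. C1 x \<noteq> 0} kC" "smooth_on {x. C1 x \<noteq> 0} fC" "smooth_on {x. C1 x \<noteq> 0} bC"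
proof -
  note i = smooth_intros open_C1 bl[THEN smooth_on_bounded_linear]
  have "complex_of_real ((cmod (C1 x))\<^sup>2 + (cmod (C2 x))\<^sup>2) \<noteq> 0" if "C1 x \<noteq> 0" for x
    using that by (metis add_pos_nonneg less_irrefl of_real_eq_0_iff zero_le_power2 zero_less_norm_iff zero_less_power)
  then show "smooth_on {x. C1 x \<noteq> 0} kC"
    unfolding kC_def[abs_def] kappa_def by (intro i) auto
  show "smooth_on {x. C1 x \<noteq> 0} zC" "smooth_on {x. C1 x \<noteq> 0} fC" "smooth_on {x. C1 x \<noteq> 0} bC"
    unfolding zC_def[abs_def] fC_def[abs_def] bC_def[abs_def] zeta_def pairing_def quartic_def
    by (intro i; simp)+
qed

lemma smooth_chart_fun: "smooth_on {x. C1 x \<noteq> 0} (chart_fun c b)"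
  unfolding chart_fun_def[abs_def] by (intro smooth_intros smooth_coords open_C1)

text \<open>A section of the orbit map in chart coordinates: on \<open>section_dom\<close> it picks
  the point of the orbit whose first coordinate is positive.\<close>

definition section_fun :: "complex \<Rightarrow> real \<Rightarrow> (real^4) \<times> (real^3) \<Rightarrow> real^8" where
  "section_fun c b y = C' (lift (Complex (fst y $ 1) (fst y $ 2)) (Complex (fst y $ 3) (fst y $ 4))
     (c + Complex (snd y $ 1) (snd y $ 2)) (b + snd y $ 3))"

definition section_dom :: "complex \<Rightarrow> real \<Rightarrow> ((real^4) \<times> (real^3)) set" where
  "section_dom c b = {y. admissible (Complex (fst y $ 3) (fst y $ 4))
     (c + Complex (snd y $ 1) (snd y $ 2)) (b + snd y $ 3)}"

lemma lift_chart:
  fixes z :: complex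
  assumes "admissible k f b"
  defines "x \<equiv> C' (lift z k f b)"
  shows "C1 x \<noteq> 0" "zC x = z" "kC x = k" "fC x = f" "bC x = b"
proof -
  obtain a1 a2 a3 a4 where a: "lift z k f b = (a1, a2, a3, a4)"
    by (cases "lift z k f b")
  show "C1 x \<noteq> 0" "zC x = z" "kC x = k" "fC x = f" "bC x = b"
    using lift_coordinates[OF assms(1) a]
    by (simp_all add: x_def a zC_def kC_def fC_def bC_def CC')
qed

lemma section_chart:
  assumes "y \<in> section_dom c b"
  shows "C1 (section_fun c b y) \<noteq> 0" "chart_fun c b (section_fun c b y) = y"
  using assms unfolding section_dom_def mem_Collect_eq section_fun_def chart_fun_def
  by (simp_all add: lift_chart enc_surj)

lemma chart_section:
  assumes "C1 x \<noteq> 0"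
  shows "chart_fun c b x \<in> section_dom c b" "\<exists>\<tau>. section_fun c b (chart_fun c b x) = flow \<tau> x"
proof -
  show "chart_fun c b x \<in> section_dom c b"
    using coordinates_admissible[OF assms]
    by (simp add: section_dom_def chart_fun_def enc_nth kC_def fC_def bC_def)
  have polar: "C1 x = cmod (C1 x) * cis (Arg (C1 x))"
    by (metis rcis_cmod_Arg rcis_def)
  \<comment> \<open>Rotating by minus the argument makes the first coordinate positive, as
    \<open>lift_of_coordinates\<close> requires.\<close>
  define y where "y = flow (- Arg (C1 x)) x"
  have "cis (- Arg (C1 x)) * (of_real (cmod (C1 x)) * cis (Arg (C1 x))) = of_real (cmod (C1 x))"
    by (simp add: cis_mult mult.left_commute)
  then have "C1 y = of_real (cmod (C1 x))"
    unfolding y_def rot polar[symmetric] .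
  then have "lift (zC y) (kC y) (fC y) (bC y) = (C1 y, C2 y, C3 y, C4 y)"
    unfolding zC_def kC_def fC_def bC_def using assms by (intro lift_of_coordinates) auto
  then have "section_fun c b (chart_fun c b y) = y"
    by (simp add: section_fun_def chart_fun_def enc_nth C'C)
  then show "\<exists>\<tau>. section_fun c b (chart_fun c b x) = flow \<tau> x"
    unfolding y_def chart_fun_flow by blast
qed

lemma open_section_dom: "open (section_dom c b)"
proof -
  have "section_dom c b = {y. 0 < b + snd y $ 3} \<union> {y. c + Complex (snd y $ 1) (snd y $ 2) \<noteq> 0}
      \<union> {y. Complex (fst y $ 3) (fst y $ 4) \<noteq> 0}"
    by (auto simp: section_dom_def admissible_def)
  also have "open \<dots>"
    unfolding Complex_eq
    by (intro open_Un open_Collect_less open_Collect_neq continuous_intros)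
  finally show ?thesis .
qed

lemma smooth_section: "smooth_on (section_dom c b) (section_fun c b)"
proof -
  let ?S = "section_dom c b"
  let ?z = "\<lambda>y. Complex (fst y $ 1) (fst y $ 2)" and ?k = "\<lambda>y. Complex (fst y $ 3) (fst y $ 4)"
    and ?f = "\<lambda>y. c + Complex (snd y $ 1) (snd y $ 2)" and ?b = "\<lambda>y. b + snd y $ 3"
  note o = open_section_dom[of c b]
  have adm: "admissible (?k y) (?f y) (?b y)" if "y \<in> ?S" for y
    using that by (simp add: section_dom_def)
  have s: "smooth_on ?S ?z" "smooth_on ?S ?k" "smooth_on ?S ?f" "smooth_on ?S ?b"
    by (intro smooth_intros o)+
  have n: "1 + (cmod z)\<^sup>2 \<noteq> 0" for z
    using one_plus_square_pos[of z] by simp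
  have u: "smooth_on ?S (\<lambda>y. usol (?z y) (?k y) (?f y) (?b y))"
    unfolding usol_def using admissible_sqrt_pos[OF adm]
    by (intro smooth_intros o s) auto
  have r: "smooth_on ?S (\<lambda>y. rho (?z y) (?k y) (?f y) (?b y))"
    unfolding rho_def using usol_pos[OF adm] one_plus_square_pos n
    by (intro smooth_intros o s u) auto
  have u0: "complex_of_real (usol (?z y) (?k y) (?f y) (?b y)) \<noteq> 0" if "y \<in> ?S" for y
    using usol_pos[OF adm[OF that]] by (metis less_irrefl of_real_eq_0_iff)
  show ?thesis
    unfolding section_fun_def[abs_def] lift_def Let_def
    by (intro smooth_on_bounded_linear[OF bl'] smooth_intros o s u r u0)
qed

text \<open>The section yields everything: points with equal chart values flow to the same section
  point, hence share an orbit, and differentiating chart after section shows that the derivative is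
  onto.\<close>

lemma chart_in_cone_charts: "(chart_dom, descend (chart_fun c b)) \<in> cone_charts"
proof -
  have comp: "descend (chart_fun c b) \<circ> proj = chart_fun c b"
    by (simp add: fun_eq_iff descend_chart_fun)
  have "inj_on (descend (chart_fun c b)) chart_dom"
  proof (rule inj_onI)
    fix p q
    assume "p \<in> chart_dom" "q \<in> chart_dom" and eq: "descend (chart_fun c b) p = descend (chart_fun c b) q"
    then obtain x y where p: "p = proj x" "C1 x \<noteq> 0" and q: "q = proj y" "C1 y \<noteq> 0"
      by (auto simp: chart_dom_def)
    have "chart_fun c b x = chart_fun c b y"
      using eq by (simp add: p q descend_chart_fun)
    then obtain \<sigma> \<tau> where "flow \<sigma> x = flow \<tau> y"
      using chart_section(2)[OF p(2), of c b] chart_section(2)[OF q(2), of c b] by metis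
    moreover have "proj x = proj (flow \<sigma> x)" "proj y = proj (flow \<tau> y)"
      using proj_eq_iff by blast+
    ultimately show "p = q"
      by (simp add: p q)
  qed
  moreover have "chart_dom \<subseteq> cone"
    using C1_0 by (auto simp: chart_dom_def cone_def)
  moreover have "surj (frechet_derivative (chart_fun c b) (at x))" if x: "C1 x \<noteq> 0" for x
  proof -
    \<comment> \<open>The section may meet the orbit of \<open>x\<close> elsewhere; composing it
      with \<open>flow (- \<tau>)\<close> makes it pass through \<open>x\<close> itself.\<close>
    obtain \<tau> where \<tau>: "section_fun c b (chart_fun c b x) = flow \<tau> x"
      using chart_section(2)[OF x] by blast
    let ?y = "chart_fun c b x" and ?s = "\<lambda>y. flow (- \<tau>) (section_fun c b y)"
    have y: "?y \<in> section_dom c b"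
      using chart_section(1)[OF x] .
    have s: "?s ?y = x"
      by (simp add: \<tau> flow_add flow_0)
    have "smooth_on (section_dom c b) ?s"
      by (intro smooth_on_bounded_linear[OF bounded_linear_flow] open_section_dom smooth_section)
    then have ds: "(?s has_derivative frechet_derivative ?s (at ?y)) (at ?y)"
      using y by (rule smooth_on_imp_has_derivative)
    have dc: "(chart_fun c b has_derivative frechet_derivative (chart_fun c b) (at x)) (at (?s ?y))"
      unfolding s using x by (intro smooth_on_imp_has_derivative[OF smooth_chart_fun]) simp
    have "((\<lambda>y. chart_fun c b (?s y)) has_derivative
        (\<lambda>h. frechet_derivative (chart_fun c b) (at x) (frechet_derivative ?s (at ?y) h))) (at ?y)"
      by (rule has_derivative_compose[OF ds dc])
    moreover have "((\<lambda>y. chart_fun c b (?s y)) has_derivative (\<lambda>h. h)) (at ?y)"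
    proof (rule has_derivative_transform_within_open)
      show "((\<lambda>y. y) has_derivative (\<lambda>h. h)) (at ?y)"
        by (rule has_derivative_ident)
      show "open (section_dom c b)" "?y \<in> section_dom c b"
        using open_section_dom y by auto
      show "y = chart_fun c b (?s y)" if "y \<in> section_dom c b" for y
        using section_chart(2)[OF that] by (simp add: chart_fun_flow)
    qed
    ultimately have "(\<lambda>h. frechet_derivative (chart_fun c b) (at x) (frechet_derivative ?s (at ?y) h)) = (\<lambda>h. h)"
      by (rule has_derivative_unique)
    then show ?thesis
      by (metis surjI)
  qed
  ultimately show ?thesis
    unfolding cone_charts_def using smooth_chart_fun open_C1
    by (simp add: comp preim_chart_dom)
qed

end

section \<open>Charts of the tangent bundle of the sphere\<close>

text \<open>A linear inner map is its own derivative, so the derivative of the composition is again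
  a composition with \<open>h\<close> and the induction closes.\<close>

lemma Ck_on_comp_bounded_linear:
  assumes "bounded_linear h" "open S" "Ck_on k S f"
  shows "Ck_on k (h -` S) (f \<circ> h)"
  using assms(3)
proof (induction k arbitrary: f)
  case 0
  then have "continuous_on S f"
    by simp
  then have "continuous_on (h -` S) (\<lambda>x. f (h x))"
    by (rule continuous_on_compose2[OF _ linear_continuous_on[OF assms(1)]]) blast
  then show ?case
    by (simp add: comp_def)
next
  case (Suc k)
  have o: "open (h -` S)"
    by (intro open_vimage assms linear_continuous_on)
  show ?case
  proof (rule Ck_on_SucI[OF o])
    show "(f \<circ> h has_derivative (\<lambda>v. frechet_derivative f (at (h x)) (h v))) (at x)" if "x \<in> h -` S" for x
      unfolding comp_def using that
      by (intro has_derivative_compose[OF bounded_linear_imp_has_derivative[OF assms(1)]]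
            Ck_on_SucD(1)[OF Suc.prems]) simp
    show "Ck_on k (h -` S) (\<lambda>x. frechet_derivative f (at (h x)) (h v))" for v
      by (rule Suc.IH[OF Ck_on_SucD(2)[OF Suc.prems], unfolded comp_def])
  qed
qed

lemma smooth_on_comp_bounded_linear:
  "bounded_linear h \<Longrightarrow> open S \<Longrightarrow> smooth_on S f \<Longrightarrow> smooth_on (h -` S) (f \<circ> h)"
  by (simp add: smooth_on_def Ck_on_comp_bounded_linear)

lemma euclidean_chartsI:
  assumes "open U" "open V" "smooth_on U \<phi>" "smooth_on V \<psi>" "\<phi> ` U \<subseteq> V" "\<psi> ` V \<subseteq> U"
    and inv: "\<And>x. x \<in> U \<Longrightarrow> \<psi> (\<phi> x) = x" "\<And>y. y \<in> V \<Longrightarrow> \<phi> (\<psi> y) = y"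
  shows "(U, \<phi>) \<in> euclidean_charts"
proof -
  have V: "\<phi> ` U = V"
    using assms by (metis image_iff image_subset_iff subsetI subset_antisym)
  have inj: "inj_on \<phi> U"
    using inv(1) by (metis inj_onI)
  have "inv_into U \<phi> y = \<psi> y" if "y \<in> V" for y
    using that inv(2)[OF that] assms(6) inj by (metis image_subset_iff inv_into_f_f)
  then have "smooth_on V (inv_into U \<phi>)"
    using assms(2,4) smooth_on_cong by metis
  then show ?thesis
    unfolding euclidean_charts_def using assms(1-3) V inj by simp
qed

lemma tangent_space_sphere:
  fixes p :: "'a::euclidean_space"
  assumes p: "norm p = 1"
  shows "tangent_space (sphere 0 1) p = {v. p \<bullet> v = 0}"
proof (intro set_eqI iffI)
  fix v
  assume v: "v \<in> tangent_space (sphere 0 1) p"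
  have "((\<lambda>y. y \<bullet> y) has_derivative (\<lambda>v. p \<bullet> v + v \<bullet> p)) (at p)"
    by (rule has_derivative_inner has_derivative_ident)+
  from tangent_space_imp_derivative_eq_0[OF v this, of 1] show "v \<in> {v. p \<bullet> v = 0}"
    by (simp add: inner_commute power2_norm_eq_inner[symmetric])
next
  fix v
  assume "v \<in> {v. p \<bullet> v = 0}"
  then have pv: "p \<bullet> v = 0"
    by simp
  \<comment> \<open>The line through \<open>p\<close> in direction \<open>v\<close>, projected
    radially to the sphere. Since \<open>v\<close> is orthogonal to \<open>p\<close>, the
    normalising factor is stationary at 0 and the velocity remains \<open>v\<close>.\<close>
  define c where "c t = inverse (sqrt (1 + t\<^sup>2 * (v \<bullet> v))) *\<^sub>R (p + t *\<^sub>R v)" for t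
  have pos: "1 + t\<^sup>2 * (v \<bullet> v) > 0" for t
    by (intro add_pos_nonneg mult_nonneg_nonneg) auto
  then have nz: "sqrt (1 + t\<^sup>2 * (v \<bullet> v)) \<noteq> 0" for t
    by (metis less_irrefl real_sqrt_eq_0_iff)
  have "smooth_on {-1<..<1} c"
    unfolding c_def[abs_def] using pos nz by (intro smooth_intros) auto
  moreover have "norm (c t) = 1" for t
  proof -
    have "(norm (p + t *\<^sub>R v))\<^sup>2 = 1 + t\<^sup>2 * (v \<bullet> v)"
      using p pv unfolding power2_norm_eq_inner norm_eq_1
      by (simp add: inner_add inner_commute power2_eq_square)
    then have "norm (p + t *\<^sub>R v) = sqrt (1 + t\<^sup>2 * (v \<bullet> v))"
      by (metis norm_ge_zero real_sqrt_unique)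
    then show ?thesis
      using pos[of t] nz[of t] by (simp add: c_def)
  qed
  moreover have "(c has_vector_derivative v) (at 0)"
  proof -
    have "((\<lambda>t. 1 + t\<^sup>2 * (v \<bullet> v)) has_real_derivative 0) (at 0)"
      by (auto intro!: derivative_eq_intros)
    then have "((\<lambda>t. sqrt (1 + t\<^sup>2 * (v \<bullet> v))) has_real_derivative 0) (at 0)"
      by (auto intro!: derivative_eq_intros)
    then have "((\<lambda>t. inverse (sqrt (1 + t\<^sup>2 * (v \<bullet> v)))) has_real_derivative 0) (at 0)"
      by (auto intro!: derivative_eq_intros)
    moreover have "((\<lambda>t. p + t *\<^sub>R v) has_vector_derivative v) (at 0)"
      by (auto intro!: derivative_eq_intros)
    ultimately show ?thesis
      unfolding c_def[abs_def] by (rule has_vector_derivative_eq_rhs[OF has_vector_derivative_scaleR]) simp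
  qed
  moreover have "c 0 = p"
    by (simp add: c_def)
  ultimately show "v \<in> tangent_space (sphere 0 1) p"
    unfolding tangent_space_def by (auto intro!: exI[of _ 1] exI[of _ c])
qed

lemma TS2_eq: "TS2 = {(p, v). norm p = 1 \<and> p \<bullet> v = 0}"
  unfolding TS2_def tangent_bundle_def by (auto simp: tangent_space_sphere)

section \<open>Stereographic coordinates and the induced fibre coordinates\<close>

definition vec3 :: "real \<Rightarrow> real \<Rightarrow> real \<Rightarrow> real^3" where
  "vec3 a b c = a *\<^sub>R axis 1 1 + b *\<^sub>R axis 2 1 + c *\<^sub>R axis 3 1"

lemma vec3_nth: "vec3 a b c $ 1 = a" "vec3 a b c $ 2 = b" "vec3 a b c $ 3 = c"
  by (simp_all add: vec3_def axis_def)

lemma smooth_on_vec3 [smooth_intros]: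
  "open S \<Longrightarrow> smooth_on S f \<Longrightarrow> smooth_on S g \<Longrightarrow> smooth_on S h \<Longrightarrow> smooth_on S (\<lambda>x. vec3 (f x) (g x) (h x))"
  unfolding vec3_def by (intro smooth_intros; assumption)

lemma inner_3: "(x :: real^3) \<bullet> y = x$1 * y$1 + x$2 * y$2 + x$3 * y$3"
  by (simp add: inner_vec_def sum_3)

lemma norm_3: "(norm (x :: real^3))\<^sup>2 = (x$1)\<^sup>2 + (x$2)\<^sup>2 + (x$3)\<^sup>2"
  by (simp add: power2_norm_eq_inner inner_3) (simp add: power2_eq_square)

text \<open>Inverse stereographic projection from the south pole (0, 0, -1).\<close>

definition phat :: "complex \<Rightarrow> real^3" where
  "phat z = inverse (1 + (cmod z)\<^sup>2) *\<^sub>R vec3 (2 * Re z) (2 * Im z) (1 - (cmod z)\<^sup>2)"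

text \<open>\<open>tvec z k\<close> is \<open>Re (k N)\<close> for the null vector \<open>N = (1 - z\<^sup>2, \<i> (1 + z\<^sup>2), -2 z)\<close>, which is orthogonal
  to \<open>phat z\<close>; \<open>ts_zeta\<close> and \<open>ts_kappa\<close> invert \<open>phat\<close> and \<open>tvec\<close>.\<close>

definition tvec :: "complex \<Rightarrow> complex \<Rightarrow> real^3" where
  "tvec z k = vec3 (Re (k * (1 - z\<^sup>2))) (Re (k * \<i> * (1 + z\<^sup>2))) (Re (- 2 * k * z))"

definition ts_zeta :: "real^3 \<Rightarrow> complex" where
  "ts_zeta p = Complex (p$1) (p$2) / of_real (norm p + p$3)"

definition ts_kappa :: "complex \<Rightarrow> real^3 \<Rightarrow> complex" where
  "ts_kappa z v = (of_real (v$1) * (1 - (cnj z)\<^sup>2) - \<i> * of_real (v$2) * (1 + (cnj z)\<^sup>2) - 2 * of_real (v$3) * cnj z)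
     / of_real ((1 + (cmod z)\<^sup>2)\<^sup>2)"

lemma one_plus_square: "1 + (cmod z)\<^sup>2 = 1 + (Re z)\<^sup>2 + (Im z)\<^sup>2"
  by (simp add: cmod_power2)

lemma one_plus_square_neq_0: "1 + (cmod z)\<^sup>2 \<noteq> 0"
  using one_plus_square_pos[of z] by simp

lemma phat_inner_phat: "phat z \<bullet> phat z = 1"
proof -
  have "vec3 (2 * Re z) (2 * Im z) (1 - (cmod z)\<^sup>2) \<bullet> vec3 (2 * Re z) (2 * Im z) (1 - (cmod z)\<^sup>2)
    = (1 + (cmod z)\<^sup>2)\<^sup>2"
    by (simp add: inner_3 vec3_nth cmod_power2) (simp add: power2_eq_square algebra_simps)
  moreover have "inverse n * (inverse n * n\<^sup>2) = 1" if "n \<noteq> 0" for n :: real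
    using that by (simp add: field_simps power2_eq_square)
  ultimately show ?thesis
    using one_plus_square_neq_0[of z] unfolding phat_def inner_scaleR_left inner_scaleR_right by simp
qed

lemma norm_phat: "norm (phat z) = 1"
  using phat_inner_phat norm_eq_1 by blast

lemma phat_inner_tvec: "phat z \<bullet> tvec z k = 0"
  by (simp add: phat_def tvec_def inner_3 vec3_nth cmod_power2)
    (simp add: power2_eq_square algebra_simps)

lemma ts_kappa_add: "ts_kappa z (v + w) = ts_kappa z v + ts_kappa z w"
  by (simp add: ts_kappa_def add_divide_distrib[symmetric] algebra_simps)

lemma ts_kappa_scaleR: "ts_kappa z (r *\<^sub>R v) = of_real r * ts_kappa z v"
  by (simp add: ts_kappa_def algebra_simps)

lemma ts_kappa_phat: "ts_kappa z (phat z) = 0"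
proof -
  have "ts_kappa z (vec3 (2 * Re z) (2 * Im z) (1 - (cmod z)\<^sup>2)) = 0"
    unfolding ts_kappa_def vec3_nth divide_eq_0_iff
    by (rule disjI1, simp add: complex_eq_iff cmod_power2) (simp add: power2_eq_square algebra_simps)
  then show ?thesis
    by (simp add: phat_def ts_kappa_scaleR)
qed

lemma ts_kappa_tvec: "ts_kappa z (tvec z k) = k"
proof -
  have "of_real (tvec z k$1) * (1 - (cnj z)\<^sup>2) - \<i> * of_real (tvec z k$2) * (1 + (cnj z)\<^sup>2)
      - 2 * of_real (tvec z k$3) * cnj z = k * of_real ((1 + (cmod z)\<^sup>2)\<^sup>2)"
    unfolding tvec_def vec3_nth
    by (simp add: complex_eq_iff cmod_power2) (simp add: power2_eq_square algebra_simps)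
  then show ?thesis
    using one_plus_square_neq_0[of z] by (simp add: ts_kappa_def del: of_real_power of_real_add)
qed

text \<open>The orthogonal decomposition of \<open>v\<close> with respect to \<open>phat z\<close>.
  After removing the common factor 1/n^2 it is a polynomial identity.\<close>

lemma tvec_ts_kappa: "tvec z (ts_kappa z v) + (phat z \<bullet> v) *\<^sub>R phat z = v"
proof -
  define n where "n = 1 + (cmod z)\<^sup>2"
  define k where "k = of_real (v$1) * (1 - (cnj z)\<^sup>2) - \<i> * of_real (v$2) * (1 + (cnj z)\<^sup>2)
    - 2 * of_real (v$3) * cnj z"
  define p where "p = vec3 (2 * Re z) (2 * Im z) (1 - (cmod z)\<^sup>2)"
  have n: "n \<noteq> 0"
    unfolding n_def by (rule one_plus_square_neq_0)
  have "tvec z (of_real r * k) = r *\<^sub>R tvec z k" for r k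
    by (simp add: tvec_def vec_eq_iff forall_3 vec3_nth algebra_simps)
  then have "tvec z (ts_kappa z v) = inverse (n\<^sup>2) *\<^sub>R tvec z k"
    unfolding ts_kappa_def n_def[symmetric] k_def[symmetric]
    by (metis divide_inverse mult.commute of_real_inverse)
  moreover have "(phat z \<bullet> v) *\<^sub>R phat z = inverse (n\<^sup>2) *\<^sub>R ((p \<bullet> v) *\<^sub>R p)"
    unfolding phat_def n_def[symmetric] p_def[symmetric] by (simp add: power2_eq_square)
  moreover have "tvec z k + (p \<bullet> v) *\<^sub>R p = n\<^sup>2 *\<^sub>R v"
    unfolding k_def p_def n_def tvec_def
    by (simp add: vec_eq_iff forall_3 vec3_nth inner_3 cmod_power2)
      (simp add: power2_eq_square algebra_simps)
  ultimately show ?thesis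
    using n by (simp add: scaleR_add_right[symmetric] del: scaleR_scaleR) simp
qed

lemma ts_zeta_phat: 
  assumes "r > 0" 
  shows "ts_zeta (r *\<^sub>R phat z) = z" "norm (r *\<^sub>R phat z) + (r *\<^sub>R phat z) $ 3 > 0"
proof -
  define n where "n = 1 + (cmod z)\<^sup>2"
  have n: "n > 0"
    unfolding n_def by (rule one_plus_square_pos)
  have "1 + (1 - (cmod z)\<^sup>2) / n = 2 / n"
    using n by (simp add: divide_simps) (simp add: n_def)
  moreover have "(r *\<^sub>R phat z) $ 3 = r * ((1 - (cmod z)\<^sup>2) / n)"
    by (simp add: phat_def vec3_nth n_def[symmetric] divide_inverse mult.commute)
  moreover have "norm (r *\<^sub>R phat z) = r"
    using assms by (simp add: norm_phat)
  ultimately have *: "norm (r *\<^sub>R phat z) + (r *\<^sub>R phat z) $ 3 = r * (2 / n)"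
    by (metis distrib_left mult.right_neutral)
  then show "norm (r *\<^sub>R phat z) + (r *\<^sub>R phat z) $ 3 > 0"
    using n assms by simp
  have "Complex ((r *\<^sub>R phat z) $ 1) ((r *\<^sub>R phat z) $ 2) = of_real (r * (2 / n)) * z"
    unfolding phat_def n_def[symmetric] complex_eq_iff Re_Im_of_real_mult
    by (simp add: vec3_nth divide_inverse)
  moreover have "complex_of_real (r * (2 / n)) \<noteq> 0"
    using n assms by simp
  ultimately show "ts_zeta (r *\<^sub>R phat z) = z"
    unfolding ts_zeta_def * by (simp del: of_real_mult of_real_divide)
qed

lemma phat_ts_zeta:
  assumes "norm p + p$3 > 0"
  shows "norm p *\<^sub>R phat (ts_zeta p) = p"
proof -
  define r where "r = norm p"
  have r2: "r\<^sup>2 = (p$1)\<^sup>2 + (p$2)\<^sup>2 + (p$3)\<^sup>2"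
    unfolding r_def by (rule norm_3)
  have s: "r + p$3 > 0"
    using assms by (simp add: r_def)
  have r: "r > 0"
    using assms unfolding r_def by (metis add.right_neutral norm_zero zero_index zero_less_norm_iff less_irrefl)
  have z: "Re (ts_zeta p) = p$1 / (r + p$3)" "Im (ts_zeta p) = p$2 / (r + p$3)"
    unfolding ts_zeta_def r_def[symmetric] by simp_all
  have "(cmod (ts_zeta p))\<^sup>2 = ((p$1)\<^sup>2 + (p$2)\<^sup>2) / (r + p$3)\<^sup>2"
    unfolding cmod_power2 z by (simp add: power_divide add_divide_distrib)
  \<comment> \<open>One factor cancels against the denominator, so that 1 + |z|^2 and 1 - |z|^2 both
    become simple fractions over \<open>r + p$3\<close>.\<close>
  also have "(p$1)\<^sup>2 + (p$2)\<^sup>2 = (r - p$3) * (r + p$3)"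
    using r2 by (simp add: power2_eq_square algebra_simps)
  finally have c: "(cmod (ts_zeta p))\<^sup>2 = (r - p$3) / (r + p$3)"
    using s by (simp add: power2_eq_square)
  then have n: "1 + (cmod (ts_zeta p))\<^sup>2 = 2 * r / (r + p$3)"
    using s by (simp add: field_simps)
  have m: "1 - (cmod (ts_zeta p))\<^sup>2 = 2 * p$3 / (r + p$3)"
    unfolding c using s by (simp add: field_simps)
  show ?thesis
    unfolding r_def[symmetric] phat_def n m z using r s
    by (simp add: vec_eq_iff forall_3 vec3_nth)
qed

text \<open>A chart of the ambient 6-space: \<open>ts_zeta\<close> is constant on rays, and the last
  two coordinates are the slice functions that cut out \<open>TS2\<close>.\<close>

definition ts_chart :: "(real^3) \<times> (real^3) \<Rightarrow> (real^4) \<times> (real^2)" where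
  "ts_chart x = (enc4 (ts_zeta (fst x)) (ts_kappa (ts_zeta (fst x)) (snd x)),
     enc2 (norm (fst x) - 1) (fst x \<bullet> snd x))"

definition ts_inv :: "(real^4) \<times> (real^2) \<Rightarrow> (real^3) \<times> (real^3)" where
  "ts_inv y = (let z = Complex (fst y $ 1) (fst y $ 2); k = Complex (fst y $ 3) (fst y $ 4); r = 1 + snd y $ 1
     in (r *\<^sub>R phat z, tvec z k + (snd y $ 2 / r) *\<^sub>R phat z))"

text \<open>The first vector must avoid the closed ray from the origin through the south
  pole.\<close>

definition ts_dom :: "((real^3) \<times> (real^3)) set" where
  "ts_dom = {x. norm (fst x) + fst x $ 3 > 0}"

lemma ts_inv_ts_chart:
  assumes "x \<in> ts_dom"
  shows "ts_inv (ts_chart x) = x"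
proof -
  obtain p v where x: "x = (p, v)"
    by (cases x)
  have p: "norm p *\<^sub>R phat (ts_zeta p) = p"
    using assms by (intro phat_ts_zeta) (simp add: ts_dom_def x)
  have "norm p \<noteq> 0"
    using assms by (auto simp: ts_dom_def x)
  then have "(p \<bullet> v) / norm p = phat (ts_zeta p) \<bullet> v"
    by (subst p[symmetric]) simp
  then show ?thesis
    by (simp add: ts_inv_def ts_chart_def x enc_nth p tvec_ts_kappa)
qed

lemma ts_chart_ts_inv:
  assumes "1 + snd y $ 1 > 0"
  shows "ts_chart (ts_inv y) = y" "ts_inv y \<in> ts_dom"
proof -
  show "ts_inv y \<in> ts_dom"
    using ts_zeta_phat(2)[OF assms] by (simp add: ts_inv_def ts_dom_def Let_def)
  show "ts_chart (ts_inv y) = y"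
    using assms ts_zeta_phat(1)[OF assms]
    by (simp add: ts_chart_def ts_inv_def Let_def ts_kappa_add ts_kappa_scaleR ts_kappa_phat
        ts_kappa_tvec enc_surj norm_phat inner_add_right phat_inner_phat phat_inner_tvec)
qed

lemma open_ts_dom: "open ts_dom"
  unfolding ts_dom_def by (intro open_Collect_less continuous_intros)

lemma smooth_ts_chart: "smooth_on ts_dom ts_chart"
proof -
  have 1: "fst x \<bullet> fst x > 0" if "x \<in> ts_dom" for x
    using that by (auto simp: ts_dom_def)
  have 2: "complex_of_real (norm (fst x) + fst x $ 3) \<noteq> 0" if "x \<in> ts_dom" for x
    using that by (metis (mono_tags, lifting) less_irrefl mem_Collect_eq of_real_eq_0_iff ts_dom_def)
  have n: "smooth_on ts_dom (\<lambda>x. norm (fst x))"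
    unfolding norm_eq_sqrt_inner by (intro smooth_intros open_ts_dom 1)
  have z: "smooth_on ts_dom (\<lambda>x. ts_zeta (fst x))"
    unfolding ts_zeta_def by (intro smooth_intros open_ts_dom n 2)
  have 3: "complex_of_real ((1 + (cmod z)\<^sup>2)\<^sup>2) \<noteq> 0" for z
    using one_plus_square_neq_0[of z] by (metis of_real_eq_0_iff power_not_zero)
  show ?thesis
    unfolding ts_chart_def[abs_def] ts_kappa_def by (intro smooth_intros open_ts_dom n z 3)
qed

lemma smooth_ts_inv: "smooth_on {y. 1 + snd y $ 1 > 0} ts_inv"
proof -
  have o: "open {y :: (real^4) \<times> (real^2). 1 + snd y $ 1 > 0}"
    by (intro open_Collect_less continuous_intros)
  show ?thesis
    unfolding ts_inv_def[abs_def] Let_def phat_def tvec_def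
    by (intro smooth_intros o one_plus_square_neq_0) auto
qed

text \<open>\<open>L\<close> is later the identity or \<open>flip\<close>, so that one chart serves
  around both poles.\<close>

context
  fixes L :: "(real^3) \<times> (real^3) \<Rightarrow> (real^3) \<times> (real^3)"
  assumes bl: "bounded_linear L" and LL: "L (L x) = x" and L_TS2: "L x \<in> TS2 \<longleftrightarrow> x \<in> TS2"
begin

lemma ts_chart_in_euclidean_charts: "(L -` ts_dom, ts_chart \<circ> L) \<in> euclidean_charts"
proof (rule euclidean_chartsI[where V = "{y. 1 + snd y $ 1 > 0}" and \<psi> = "L \<circ> ts_inv"])
  show V: "open {y :: (real^4) \<times> (real^2). 1 + snd y $ 1 > 0}"
    by (intro open_Collect_less continuous_intros)
  show o: "open (L -` ts_dom)"
    by (intro open_vimage open_ts_dom linear_continuous_on bl)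
  show "smooth_on {y. 1 + snd y $ 1 > 0} (L \<circ> ts_inv)"
    unfolding comp_def by (intro smooth_on_bounded_linear[OF bl] V smooth_ts_inv)
  show "smooth_on (L -` ts_dom) (ts_chart \<circ> L)"
    by (intro smooth_on_comp_bounded_linear bl open_ts_dom smooth_ts_chart)
  show "(ts_chart \<circ> L) ` (L -` ts_dom) \<subseteq> {y. 1 + snd y $ 1 > 0}"
    by (auto simp: ts_chart_def ts_dom_def enc_nth)
  show "(L \<circ> ts_inv) ` {y. 1 + snd y $ 1 > 0} \<subseteq> L -` ts_dom"
    by (auto simp: LL ts_chart_ts_inv)
qed (auto simp: LL ts_chart_ts_inv ts_inv_ts_chart)

lemma ts_chart_in_TS2_charts: "(L -` ts_dom \<inter> TS2, fst \<circ> (ts_chart \<circ> L)) \<in> TS2_charts"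
proof -
  have "x \<in> TS2 \<longleftrightarrow> snd ((ts_chart \<circ> L) x) = 0" for x
    unfolding L_TS2[of x, symmetric] by (auto simp: TS2_eq ts_chart_def enc_eq_0_iff split: prod.splits)
  then show ?thesis
    unfolding TS2_charts_def submanifold_charts_def using ts_chart_in_euclidean_charts by blast
qed

end

section \<open>The level sets\<close>

lemma diffeomorphic_by_charts:
  fixes F :: "'p \<Rightarrow> 'q" and \<phi> :: "'i \<Rightarrow> 'p \<Rightarrow> 'e::euclidean_space" and \<psi> :: "'i \<Rightarrow> 'q \<Rightarrow> 'e"
  assumes charts: "\<And>i. (U i, \<phi> i) \<in> A" "\<And>i. (V i, \<psi> i) \<in> B"
    and cover: "M = (\<Union>i. U i)" "N = (\<Union>i. V i)"
    and F: "\<And>i x. x \<in> M \<Longrightarrow> F x \<in> V i \<longleftrightarrow> x \<in> U i" "\<And>i x. x \<in> U i \<Longrightarrow> \<psi> i (F x) = \<phi> i x"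
    and inj: "\<And>i. inj_on (\<phi> i) (U i)" "\<And>i. inj_on (\<psi> i) (V i)"
    and surj: "\<And>i. \<phi> i ` U i = UNIV"
  shows "diffeomorphic M A N B"
  unfolding diffeomorphic_def
proof (intro exI conjI)
  have sub: "U i \<subseteq> M" "V i \<subseteq> N" for i
    using cover by auto
  have FU: "F ` U i = V i" for i
  proof
    show "F ` U i \<subseteq> V i"
      using F(1) sub(1) by blast
    show "V i \<subseteq> F ` U i"
    proof
      fix y assume y: "y \<in> V i"
      have "\<psi> i y \<in> \<phi> i ` U i"
        by (simp add: surj)
      then obtain x where x: "x \<in> U i" "\<psi> i y = \<phi> i x"
        by (rule imageE)
      have "F x \<in> V i"
        using x(1) sub(1)[of i] F(1)[of x i] by blast
      moreover have "\<psi> i (F x) = \<psi> i y"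
        using F(2)[OF x(1)] x(2) by simp
      ultimately have "F x = y"
        using y by (intro inj_onD[OF inj(2)])
      with x(1) show "y \<in> F ` U i"
        by blast
    qed
  qed
  have inj_F: "inj_on F M"
  proof (rule inj_onI)
    fix x y assume xy: "x \<in> M" "y \<in> M" "F x = F y"
    then obtain i where x: "x \<in> U i"
      using cover(1) by blast
    then have y: "y \<in> U i"
      using F(1)[of x i] F(1)[of y i] xy by simp
    have "\<phi> i x = \<phi> i y"
      using F(2)[OF x] F(2)[OF y] xy(3) by simp
    then show "x = y"
      using x y by (intro inj_onD[OF inj(1)])
  qed
  show "bij_betw F M N"
    unfolding bij_betw_def cover(2) using inj_F by (simp add: cover(1) image_UN FU)
  have inv: "inv_into M F (F x) = x" if "x \<in> U i" for x i
    using inj_F that sub(1)[of i] by (intro inv_into_f_f) auto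
  have "(\<psi> i \<circ> F \<circ> inv_into (U i) (\<phi> i)) y = y" for i y
  proof -
    have y: "y \<in> \<phi> i ` U i"
      by (simp add: surj)
    show ?thesis
      using F(2)[OF inv_into_into[OF y]] f_inv_into_f[OF y] by simp
  qed
  then have 1: "smooth_on (\<phi> i ` U i) (\<psi> i \<circ> F \<circ> inv_into (U i) (\<phi> i))" for i
    unfolding surj by (subst smooth_on_cong[where g = "\<lambda>y. y"]) (simp_all add: smooth_on_id)
  show "smooth_map M A B F"
    unfolding smooth_map_def
  proof
    fix p assume "p \<in> M"
    then obtain i where "p \<in> U i"
      using cover(1) by blast
    then show "\<exists>(U, \<phi>)\<in>A. \<exists>(V, \<psi>)\<in>B. p \<in> U \<and> F ` U \<subseteq> V \<and> smooth_on (\<phi> ` U) (\<psi> \<circ> F \<circ> inv_into U \<phi>)"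
      using 1[of i] FU[of i]
      by (intro bexI[OF _ charts(1)[of i]] case_prodI bexI[OF _ charts(2)[of i]]) simp
  qed
  have V: "\<psi> i ` V i = UNIV" for i
    unfolding FU[symmetric] surj[of i, symmetric] image_image using F(2) by (intro image_cong) auto
  have "(\<phi> i \<circ> inv_into M F \<circ> inv_into (V i) (\<psi> i)) y = y" for i y
  proof -
    have y: "y \<in> \<psi> i ` V i"
      by (simp add: V)
    obtain x where x: "x \<in> U i" "inv_into (V i) (\<psi> i) y = F x"
      using inv_into_into[OF y] unfolding FU[symmetric] by blast
    then show ?thesis
      using F(2)[OF x(1)] f_inv_into_f[OF y] inv[OF x(1)] by simp
  qed
  then have 2: "smooth_on (\<psi> i ` V i) (\<phi> i \<circ> inv_into M F \<circ> inv_into (V i) (\<psi> i))" for i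
    unfolding V by (subst smooth_on_cong[where g = "\<lambda>y. y"]) (simp_all add: smooth_on_id)
  show "smooth_map N B A (inv_into M F)"
    unfolding smooth_map_def
  proof
    fix q assume "q \<in> N"
    then obtain i where "q \<in> V i"
      using cover(2) by blast
    moreover have "inv_into M F ` V i \<subseteq> U i"
      unfolding FU[symmetric] using inv by auto
    ultimately show "\<exists>(V, \<psi>)\<in>B. \<exists>(U, \<phi>)\<in>A. q \<in> V \<and> inv_into M F ` V \<subseteq> U \<and>
        smooth_on (\<psi> ` V) (\<phi> \<circ> inv_into M F \<circ> inv_into V \<psi>)"
      using 2[of i] by (intro bexI[OF _ charts(2)[of i]] case_prodI bexI[OF _ charts(1)[of i]]) simp
  qed
qed

text \<open>In the charts of the cone and of the tangent bundle, \<open>hopf\<close> is the identity.\<close>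

definition hopf :: "complex \<Rightarrow> complex \<Rightarrow> complex \<Rightarrow> complex \<Rightarrow> (real^3) \<times> (real^3)" where
  "hopf a1 a2 a3 a4 = (let u = (cmod a1)\<^sup>2 + (cmod a2)\<^sup>2; d = cnj (a1 * a4 - a2 * a3) / of_real u
     in (inverse u *\<^sub>R vec3 (2 * Re (cnj a1 * a2)) (2 * Im (cnj a1 * a2)) ((cmod a1)\<^sup>2 - (cmod a2)\<^sup>2),
        vec3 (Re (d * (a1\<^sup>2 - a2\<^sup>2))) (Re (d * \<i> * (a1\<^sup>2 + a2\<^sup>2))) (Re (- 2 * d * a1 * a2))))"

text \<open>The half-turn about the first axis in both factors; in the stereographic coordinate of
  the sphere it is z -> 1/z.\<close>

definition flip :: "(real^3) \<times> (real^3) \<Rightarrow> (real^3) \<times> (real^3)" where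
  "flip x = (vec3 (fst x $ 1) (- (fst x $ 2)) (- (fst x $ 3)), vec3 (snd x $ 1) (- (snd x $ 2)) (- (snd x $ 3)))"

text \<open>\<open>hopf\<close> is written without division by \<open>a1\<close>, so it also makes
  sense off the chart domain; substituting \<open>a2 = a1 * z\<close> recovers the stereographic
  formulas.\<close>

lemma hopf_eq_tangent:
  assumes "a1 \<noteq> 0"
  shows "hopf a1 a2 a3 a4 = (phat (zeta a1 a2), tvec (zeta a1 a2) (kappa a1 a2 a3 a4))"
proof -
  define z where "z = zeta a1 a2"
  define d where "d = cnj (a1 * a4 - a2 * a3) / of_real ((cmod a1)\<^sup>2 + (cmod a2)\<^sup>2)"
  define r where "r = (cmod a1)\<^sup>2"
  have r: "r > 0" and rc: "cnj a1 * a1 = of_real r"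
    using assms complex_norm_square[of a1] by (auto simp: r_def mult.commute)
  have a2: "a2 = a1 * z"
    using assms by (simp add: z_def zeta_def)
  have m: "(cmod a2)\<^sup>2 = r * (cmod z)\<^sup>2"
    by (simp add: a2 r_def norm_mult power_mult_distrib)
  have k: "kappa a1 a2 a3 a4 = a1\<^sup>2 * d"
    by (simp add: kappa_def d_def)
  have c: "cnj a1 * a2 = of_real r * z"
    unfolding a2 rc[symmetric] by simp
  have n: "r + r * (cmod z)\<^sup>2 = r * (1 + (cmod z)\<^sup>2)"
    by (simp add: algebra_simps)
  have "inverse (r * s) *\<^sub>R vec3 (2 * (r * x)) (2 * (r * y)) (r - r * w) = inverse s *\<^sub>R vec3 (2 * x) (2 * y) (1 - w)"
    if "s > 0" for s x y w
    using r that by (simp add: vec_eq_iff forall_3 vec3_nth field_simps)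
  then have 1: "inverse (r + r * (cmod z)\<^sup>2) *\<^sub>R vec3 (2 * Re (cnj a1 * a2)) (2 * Im (cnj a1 * a2)) (r - r * (cmod z)\<^sup>2)
    = phat z"
    unfolding c Re_Im_of_real_mult n phat_def using one_plus_square_pos by blast
  have 2: "d * (a1\<^sup>2 - a2\<^sup>2) = a1\<^sup>2 * d * (1 - z\<^sup>2)" "d * \<i> * (a1\<^sup>2 + a2\<^sup>2) = a1\<^sup>2 * d * \<i> * (1 + z\<^sup>2)"
    "- 2 * d * a1 * a2 = - 2 * (a1\<^sup>2 * d) * z"
    unfolding a2 by (simp_all add: algebra_simps power2_eq_square)
  show ?thesis
    unfolding hopf_def Let_def d_def[symmetric] z_def[symmetric] k tvec_def 2
    unfolding m r_def[symmetric] 1 ..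
qed

lemma hopf_swap: "hopf a2 a1 a4 a3 = flip (hopf a1 a2 a3 a4)"
proof -
  define u where "u = (cmod a1)\<^sup>2 + (cmod a2)\<^sup>2"
  define d where "d = cnj (a1 * a4 - a2 * a3) / of_real u"
  have u: "(cmod a2)\<^sup>2 + (cmod a1)\<^sup>2 = u"
    by (simp add: u_def)
  have d: "cnj (a2 * a3 - a1 * a4) / of_real u = - d"
    by (simp add: d_def minus_divide_left)
  show ?thesis
    unfolding hopf_def Let_def u u_def[symmetric] d d_def[symmetric] flip_def
    by (simp add: vec3_nth vec_eq_iff forall_3 algebra_simps)
qed

lemma hopf_rotate:
  assumes "cmod c = 1"
  shows "hopf (c * a1) (c * a2) (c * a3) (c * a4) = hopf a1 a2 a3 a4"
proof -
  have c: "cnj c * c = 1"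
    using assms complex_norm_square[of c] by (simp add: mult.commute)
  define u where "u = (cmod a1)\<^sup>2 + (cmod a2)\<^sup>2"
  have "cnj (c * a1) * (c * a2) = (cnj c * c) * (cnj a1 * a2)"
    by (simp add: algebra_simps)
  moreover have "cnj (c * a1 * (c * a4) - c * a2 * (c * a3)) / of_real u * (c\<^sup>2 * y)
     = (cnj c * c)\<^sup>2 * (cnj (a1 * a4 - a2 * a3) / of_real u * y)" for y
    by (simp add: algebra_simps power2_eq_square diff_divide_distrib)
  moreover have "(c * a1)\<^sup>2 - (c * a2)\<^sup>2 = c\<^sup>2 * (a1\<^sup>2 - a2\<^sup>2)" 
     "x * \<i> * ((c * a1)\<^sup>2 + (c * a2)\<^sup>2) = x * (c\<^sup>2 * (\<i> * (a1\<^sup>2 + a2\<^sup>2)))"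
     "- 2 * x * (c * a1) * (c * a2) = x * (c\<^sup>2 * (- 2 * a1 * a2))" 
     "- 2 * x * a1 * a2 = x * (- 2 * a1 * a2)" for x
    by (simp_all add: algebra_simps power2_eq_square)
  ultimately show ?thesis
    unfolding hopf_def Let_def norm_mult assms mult_1 u_def[symmetric] c
    by (simp only: power_one mult_1 mult.assoc)
qed

lemma bounded_linear_flip: "bounded_linear flip"
  unfolding linear_conv_bounded_linear[symmetric]
  by (rule linearI) (simp_all add: flip_def vec_eq_iff forall_3 vec3_nth)

lemma flip_flip: "flip (flip x) = x"
  by (cases x) (simp add: flip_def vec_eq_iff forall_3 vec3_nth)

lemma flip_in_TS2: "flip x \<in> TS2 \<longleftrightarrow> x \<in> TS2"
proof (cases x)
  case (Pair p v)
  have "norm (vec3 (p $ 1) (- (p $ 2)) (- (p $ 3))) = norm p"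
    unfolding norm_eq_sqrt_inner by (simp add: inner_3 vec3_nth)
  then show ?thesis
    by (auto simp: Pair TS2_eq flip_def inner_3 vec3_nth)
qed

lemma TS2_covered: "x \<in> TS2 \<Longrightarrow> x \<in> ts_dom \<or> flip x \<in> ts_dom"
proof -
  assume x: "x \<in> TS2"
  moreover have "flip x \<in> TS2"
    using x by (simp add: flip_in_TS2)
  ultimately have "norm (fst x) = 1" "norm (fst (flip x)) = 1"
    by (auto simp: TS2_eq)
  moreover have "fst (flip x) $ 3 = - (fst x $ 3)"
    by (simp add: flip_def vec3_nth)
  ultimately show ?thesis
    unfolding ts_dom_def mem_Collect_eq by linarith
qed

lemma bounded_linear_permute:
  "bounded_linear (\<lambda>a :: c4. (fst (snd a), fst a, snd (snd (snd a)), fst (snd (snd a))))"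
  "bounded_linear (\<lambda>a :: c4. (fst (snd (snd a)), snd (snd (snd a)), fst a, fst (snd a)))"
  unfolding linear_conv_bounded_linear[symmetric] by (rule linearI; simp)+

text \<open>Supplies the chart around the other pole, where \<open>zeta\<close> is replaced by its
  reciprocal.\<close>

lemma frame_swap:
  assumes "frame C1 C2 C3 C4 C'"
  shows "frame C2 C1 C4 C3 (\<lambda>a. C' (fst (snd a), fst a, snd (snd (snd a)), fst (snd (snd a))))"
proof -
  interpret frame C1 C2 C3 C4 C'
    by fact
  show ?thesis
    by (rule frame.intro)
      (simp_all add: rot CC' C'C bl bounded_linear_compose[OF bl' bounded_linear_permute(1)])
qed

section \<open>Level sets within one frame\<close>

context frame
begin

definition level_set :: "complex \<Rightarrow> real \<Rightarrow> (real^8) set set" where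
  "level_set c b = {proj x | x. x \<noteq> 0 \<and> fC x = c \<and> bC x = b}"

definition hopfC :: "real^8 \<Rightarrow> (real^3) \<times> (real^3)" where
  "hopfC x = hopf (C1 x) (C2 x) (C3 x) (C4 x)"

lemma descend_hopfC: "descend hopfC (proj x) = hopfC x"
  by (rule descend_proj) (simp add: hopfC_def rot hopf_rotate)

lemma coords_eqI:
  assumes "proj x = proj y"
  shows "fC y = fC x" "bC y = bC x" "C1 y = 0 \<longleftrightarrow> C1 x = 0"
proof -
  obtain \<tau> where "y = flow \<tau> x"
    using assms unfolding proj_eq_iff ..
  then show "fC y = fC x" "bC y = bC x" "C1 y = 0 \<longleftrightarrow> C1 x = 0"
    by (simp_all add: coords_flow rot)
qed

lemma proj_in_level_set:
  assumes "x \<noteq> 0"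
  shows "proj x \<in> level_set c b \<longleftrightarrow> fC x = c \<and> bC x = b"
proof
  assume "proj x \<in> level_set c b"
  then obtain y where "proj x = proj y" "fC y = c" "bC y = b"
    unfolding level_set_def by auto
  then show "fC x = c \<and> bC x = b"
    using coords_eqI(1,2) by metis
next
  assume "fC x = c \<and> bC x = b"
  with assms show "proj x \<in> level_set c b"
    unfolding level_set_def by (intro CollectI exI[of _ x]) simp
qed

lemma proj_in_chart_dom: "proj x \<in> chart_dom \<longleftrightarrow> C1 x \<noteq> 0"
proof
  assume "proj x \<in> chart_dom"
  then obtain y where "proj x = proj y" "C1 y \<noteq> 0"
    unfolding chart_dom_def by auto
  then show "C1 x \<noteq> 0"
    using coords_eqI(3) by metis
next
  assume "C1 x \<noteq> 0"
  then show "proj x \<in> chart_dom"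
    unfolding chart_dom_def by (intro CollectI exI[of _ x]) simp
qed

lemma C1_neq_0: "C1 x \<noteq> 0 \<Longrightarrow> x \<noteq> 0"
  using C1_0 by auto

lemma chart_dom_level_setE:
  assumes "p \<in> chart_dom \<inter> level_set c b"
  obtains x where "p = proj x" "C1 x \<noteq> 0" "fC x = c" "bC x = b"
  using assms by (auto simp: level_set_def proj_in_chart_dom)

lemma snd_chart_eq_0_iff:
  assumes "p \<in> chart_dom"
  shows "snd (descend (chart_fun c b) p) = 0 \<longleftrightarrow> p \<in> level_set c b"
proof -
  obtain x where x: "p = proj x" "C1 x \<noteq> 0"
    using assms unfolding chart_dom_def by blast
  show ?thesis
    unfolding x(1) descend_chart_fun proj_in_level_set[OF C1_neq_0[OF x(2)]] chart_fun_def
    by (simp add: enc_eq_0_iff)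
qed

lemma level_set_chart:
  "(chart_dom \<inter> level_set c b, fst \<circ> descend (chart_fun c b)) \<in> W_charts (level_set c b)"
proof -
  have "descend (chart_fun c b) ` (chart_dom \<inter> level_set c b) =
      {y \<in> descend (chart_fun c b) ` chart_dom. snd y = 0}"
    using snd_chart_eq_0_iff[of _ c b] by blast
  then show ?thesis
    unfolding W_charts_def submanifold_charts_def
    by (intro CollectI exI conjI) (rule refl chart_in_cone_charts | assumption)+
qed

lemma inj_level_set_chart: "inj_on (fst \<circ> descend (chart_fun c b)) (chart_dom \<inter> level_set c b)"
proof (rule inj_onI)
  have inj_chart: "inj_on (descend (chart_fun c b)) chart_dom"
    using chart_in_cone_charts[of c b] by (simp add: cone_charts_def)
  fix p q
  assume p: "p \<in> chart_dom \<inter> level_set c b" and q: "q \<in> chart_dom \<inter> level_set c b"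
    and "(fst \<circ> descend (chart_fun c b)) p = (fst \<circ> descend (chart_fun c b)) q"
  moreover have "snd (descend (chart_fun c b) p) = 0" "snd (descend (chart_fun c b) q) = 0"
    using p q snd_chart_eq_0_iff by simp_all
  ultimately have "descend (chart_fun c b) p = descend (chart_fun c b) q"
    by (simp add: prod_eq_iff)
  then show "p = q"
    using p q by (intro inj_onD[OF inj_chart]) auto
qed

text \<open>The hypothesis makes every \<open>k\<close> admissible with \<open>c\<close> and
  \<open>b\<close>, so \<open>lift\<close> realises each value of the coordinates.\<close>

lemma level_set_chart_surj:
  assumes "b > 0 \<or> c \<noteq> 0"
  shows "(fst \<circ> descend (chart_fun c b)) ` (chart_dom \<inter> level_set c b) = UNIV"
proof -
  have "y \<in> (fst \<circ> descend (chart_fun c b)) ` (chart_dom \<inter> level_set c b)" for y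
  proof -
    let ?z = "Complex (y $ 1) (y $ 2)" and ?k = "Complex (y $ 3) (y $ 4)"
    have adm: "admissible ?k c b"
      using assms by (auto simp: admissible_def)
    note x = lift_chart[OF adm, of ?z]
    let ?p = "proj (C' (lift ?z ?k c b))"
    have "?p \<in> chart_dom \<inter> level_set c b"
      using x C1_neq_0[OF x(1)] by (simp add: proj_in_chart_dom proj_in_level_set)
    moreover have "(fst \<circ> descend (chart_fun c b)) ?p = y"
      by (simp add: descend_chart_fun chart_fun_def x enc_surj)
    ultimately show ?thesis
      by (intro image_eqI[where x = ?p]) (simp_all only:)
  qed
  then show ?thesis
    by (intro subset_antisym subset_UNIV subsetI)
qed

lemma hopf_chart:
  assumes "p \<in> chart_dom \<inter> level_set c b"
  shows "descend hopfC p \<in> TS2" "fst (ts_chart (descend hopfC p)) = fst (descend (chart_fun c b) p)"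
    "descend hopfC p \<in> ts_dom"
proof -
  obtain x where x: "p = proj x" "C1 x \<noteq> 0"
    using assms by (rule chart_dom_level_setE)
  have h: "descend hopfC p = (phat (zC x), tvec (zC x) (kC x))"
    unfolding x(1) descend_hopfC hopfC_def zC_def kC_def by (rule hopf_eq_tangent[OF x(2)])
  show "descend hopfC p \<in> TS2"
    unfolding h by (simp add: TS2_eq norm_phat phat_inner_tvec)
  have "ts_zeta (phat (zC x)) = zC x" "norm (phat (zC x)) + phat (zC x) $ 3 > 0"
    using ts_zeta_phat[of 1 "zC x"] by simp_all
  then show "fst (ts_chart (descend hopfC p)) = fst (descend (chart_fun c b) p)"
    "descend hopfC p \<in> ts_dom"
    unfolding h unfolding x(1) descend_chart_fun
    by (simp_all add: ts_chart_def chart_fun_def ts_kappa_tvec ts_dom_def)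
qed

lemma hopf_in_ts_dom:
  assumes "hopfC x \<in> ts_dom"
  shows "C1 x \<noteq> 0"
proof
  assume 0: "C1 x = 0"
  \<comment> \<open>The value is the south pole, or 0 when \<open>C2 x\<close> vanishes as well,
    because \<open>inverse 0 = 0\<close>; \<open>ts_dom\<close> excludes both.\<close>
  have "fst (hopfC x) = (if C2 x = 0 then 0 else - vec3 0 0 1)"
    by (simp add: hopfC_def hopf_def Let_def 0 vec_eq_iff forall_3 vec3_nth)
  moreover have "norm (- vec3 0 0 1) = 1"
    by (simp add: norm_eq_1 inner_3 vec3_nth)
  ultimately have "norm (fst (hopfC x)) + fst (hopfC x) $ 3 = 0"
    by (simp add: vec3_nth)
  with assms show False
    by (simp add: ts_dom_def)
qed

lemma level_set_covered:
  assumes "b > 0 \<or> c \<noteq> 0" "b \<ge> 0" "fC x = c" "bC x = b"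
  shows "C1 x \<noteq> 0 \<or> C2 x \<noteq> 0"
proof (rule ccontr)
  assume "\<not> ?thesis"
  then have "C1 x = 0" "C2 x = 0"
    by simp_all
  then have "fC x = 0" "bC x \<le> 0"
    by (simp_all add: fC_def bC_def pairing_def quartic_def)
  with assms show False
    by simp
qed

text \<open>\<open>pairing\<close> and \<open>quartic\<close> are symmetric under the exchange, so
  both frames have the same level sets, and their maps to the bundle differ by
  \<open>flip\<close>.\<close>

lemma swapped_coords:
  "frame.fC C2 C1 C4 C3 = fC" "frame.bC C2 C1 C4 C3 = bC" "frame.hopfC C2 C1 C4 C3 x = flip (hopfC x)"
proof -
  interpret swapped: frame C2 C1 C4 C3 "\<lambda>a. C' (fst (snd a), fst a, snd (snd (snd a)), fst (snd (snd a)))"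
    by (rule frame_swap[OF frame_axioms])
  show "swapped.fC = fC" "swapped.bC = bC"
    by (simp_all add: fun_eq_iff swapped.fC_def fC_def swapped.bC_def bC_def pairing_def quartic_def
        add.commute)
  show "swapped.hopfC x = flip (hopfC x)"
    unfolding swapped.hopfC_def hopfC_def by (rule hopf_swap)
qed

text \<open>The charts of the frame and of the swapped frame cover the level set;
  \<open>hopfC\<close> matches them with \<open>ts_chart\<close> and
  \<open>ts_chart \<circ> flip\<close>.\<close>

lemma level_set_embedded_and_diffeomorphic:
  assumes nz: "b > 0 \<or> c \<noteq> 0" and b: "b \<ge> 0"
  shows "embedded_submanifold (cone_charts :: (_, (real^4) \<times> (real^3)) chart set) (level_set c b)"
    "diffeomorphic (level_set c b) (W_charts (level_set c b)) TS2 TS2_charts"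
proof -
  interpret swapped: frame C2 C1 C4 C3 "\<lambda>a. C' (fst (snd a), fst a, snd (snd (snd a)), fst (snd (snd a)))"
    by (rule frame_swap[OF frame_axioms])
  have W: "swapped.level_set c b = level_set c b"
    unfolding swapped.level_set_def level_set_def swapped_coords ..
  have H: "descend swapped.hopfC p = flip (descend hopfC p)" for p
    unfolding descend_def swapped_coords ..
  \<comment> \<open>The index is a boolean: \<open>True\<close> for the given frame,
    \<open>False\<close> for the swapped one.\<close>
  define dom where "dom i = (if i then chart_dom else swapped.chart_dom)" for i
  define \<phi> where "\<phi> i = (if i then descend (chart_fun c b) else descend (swapped.chart_fun c b))" for i
  define L where "L i = (if i then (\<lambda>x. x) else flip)" for i
  define U where "U i = dom i \<inter> level_set c b" for i
  have chart: "(U i, fst \<circ> \<phi> i) \<in> W_charts (level_set c b)" for i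
    using level_set_chart[of c b] swapped.level_set_chart[of c b] by (simp add: U_def dom_def \<phi>_def W)
  have in_U: "\<exists>i. p \<in> U i" if p: "p \<in> level_set c b" for p
  proof -
    obtain x where x: "p = proj x" "fC x = c" "bC x = b"
      using p unfolding level_set_def by auto
    show ?thesis
    proof (cases "C1 x = 0")
      case True
      then have "C2 x \<noteq> 0"
        using level_set_covered[OF nz b x(2,3)] by simp
      then have "p \<in> U False"
        using p by (simp add: U_def dom_def x(1) swapped.proj_in_chart_dom)
      then show ?thesis ..
    next
      case False
      then have "p \<in> U True"
        using p by (simp add: U_def dom_def x(1) proj_in_chart_dom)
      then show ?thesis ..
    qed
  qed
  have U_sub: "U i \<subseteq> level_set c b" for i
    by (simp add: U_def)
  have cover: "level_set c b = (\<Union>i. U i)"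
  proof
    show "level_set c b \<subseteq> (\<Union>i. U i)"
      using in_U by (intro subsetI) (simp add: UN_iff)
    show "(\<Union>i. U i) \<subseteq> level_set c b"
      by (rule UN_least) (rule U_sub)
  qed
  have "\<exists>ch\<in>W_charts (level_set c b). p \<in> fst ch" if p: "p \<in> level_set c b" for p
  proof -
    obtain i where "p \<in> U i"
      using in_U[OF p] ..
    then show ?thesis
      by (intro bexI[OF _ chart[of i]]) simp
  qed
  moreover have "fst ch \<subseteq> level_set c b" if "ch \<in> W_charts (level_set c b)" for ch
    using that by (auto simp: W_charts_def submanifold_charts_def)
  ultimately show "embedded_submanifold (cone_charts :: (_, (real^4) \<times> (real^3)) chart set) (level_set c b)"
    unfolding embedded_submanifold_def W_charts_def[symmetric] case_prod_beta
    by (intro subset_antisym UN_least subsetI) (auto simp only: UN_iff dest: subsetD)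
  have L: "bounded_linear (L i)" "L i (L i x) = x" "L i x \<in> TS2 \<longleftrightarrow> x \<in> TS2" for i x
    by (simp_all add: L_def bounded_linear_flip flip_flip flip_in_TS2)
  have h: "L i (descend hopfC p) \<in> TS2" "fst (ts_chart (L i (descend hopfC p))) = fst (\<phi> i p)"
      "L i (descend hopfC p) \<in> ts_dom" if "p \<in> U i" for p i
    using that hopf_chart[of p c b] swapped.hopf_chart[of p c b] unfolding H W
    by (cases i; simp add: U_def dom_def \<phi>_def L_def)+
  show "diffeomorphic (level_set c b) (W_charts (level_set c b)) TS2 TS2_charts"
  proof (rule diffeomorphic_by_charts[where U = U and \<phi> = "\<lambda>i. fst \<circ> \<phi> i"
        and V = "\<lambda>i. L i -` ts_dom \<inter> TS2" and \<psi> = "\<lambda>i. fst \<circ> (ts_chart \<circ> L i)" and F = "descend hopfC"])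
    show "(L i -` ts_dom \<inter> TS2, fst \<circ> (ts_chart \<circ> L i)) \<in> TS2_charts" for i
      by (rule ts_chart_in_TS2_charts[OF L])
    show "TS2 = (\<Union>i. L i -` ts_dom \<inter> TS2)"
      using TS2_covered by (auto simp: L_def UNIV_bool)
    show "inj_on (fst \<circ> \<phi> i) (U i)" "(fst \<circ> \<phi> i) ` U i = UNIV" for i
      using inj_level_set_chart[of c b] swapped.inj_level_set_chart[of c b]
        level_set_chart_surj[OF nz] swapped.level_set_chart_surj[OF nz]
      by (simp_all add: U_def dom_def \<phi>_def W)
    show "inj_on (fst \<circ> (ts_chart \<circ> L i)) (L i -` ts_dom \<inter> TS2)" for i
    proof (rule inj_onI)
      fix x y
      assume x: "x \<in> L i -` ts_dom \<inter> TS2" and y: "y \<in> L i -` ts_dom \<inter> TS2"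
        and eq: "(fst \<circ> (ts_chart \<circ> L i)) x = (fst \<circ> (ts_chart \<circ> L i)) y"
      \<comment> \<open>The slice coordinates vanish on \<open>TS2\<close>, so there the first
        component of \<open>ts_chart\<close> determines the point.\<close>
      have "snd (ts_chart w) = 0" if "w \<in> TS2" for w
        using that by (auto simp: TS2_eq ts_chart_def enc_eq_0_iff)
      then have "ts_chart (L i x) = ts_chart (L i y)"
        using eq x y L(3) by (simp add: prod_eq_iff)
      then have "L i x = L i y"
        using x y ts_inv_ts_chart by (metis IntD1 vimageD)
      then show "x = y"
        by (metis L(2))
    qed
    show "descend hopfC p \<in> L i -` ts_dom \<inter> TS2 \<longleftrightarrow> p \<in> U i" if p: "p \<in> level_set c b" for p i
    proof
      assume "p \<in> U i"
      then show "descend hopfC p \<in> L i -` ts_dom \<inter> TS2"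
        using h L(3) by auto
    next
      assume "descend hopfC p \<in> L i -` ts_dom \<inter> TS2"
      moreover obtain x where x: "p = proj x"
        using p by (auto simp: level_set_def)
      ultimately have "L i (hopfC x) \<in> ts_dom"
        by (simp add: descend_hopfC)
      then have "p \<in> dom i"
        using hopf_in_ts_dom[of x] swapped.hopf_in_ts_dom[of x]
        by (cases i) (simp_all add: L_def dom_def x proj_in_chart_dom swapped.proj_in_chart_dom swapped_coords)
      with p show "p \<in> U i"
        by (simp add: U_def)
    qed
    show "(fst \<circ> (ts_chart \<circ> L i)) (descend hopfC p) = (fst \<circ> \<phi> i) p" if "p \<in> U i" for p i
      using h(2)[OF that] by simp
  qed (use chart cover in auto)
qed

end

section \<open>The two orders of the halves, and the theorem\<close>

definition cz_inv :: "c4 \<Rightarrow> real^8" where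
  "cz_inv a = (case a of (a1, a2, a3, a4) \<Rightarrow>
     Re a1 *\<^sub>R pd 0 + Im a1 *\<^sub>R pd 1 - Re a4 *\<^sub>R pd 2 + Im a4 *\<^sub>R pd 3
     + Re a2 *\<^sub>R pd 4 + Im a2 *\<^sub>R pd 5 + Re a3 *\<^sub>R pd 6 - Im a3 *\<^sub>R pd 7)"

lemma cz_inv_nth:
  "cz_inv (a1, a2, a3, a4) $ 0 = Re a1" "cz_inv (a1, a2, a3, a4) $ 1 = Im a1"
  "cz_inv (a1, a2, a3, a4) $ 2 = - Re a4" "cz_inv (a1, a2, a3, a4) $ 3 = Im a4"
  "cz_inv (a1, a2, a3, a4) $ 4 = Re a2" "cz_inv (a1, a2, a3, a4) $ 5 = Im a2"
  "cz_inv (a1, a2, a3, a4) $ 6 = Re a3" "cz_inv (a1, a2, a3, a4) $ 7 = - Im a3"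
  by (simp_all add: cz_inv_def axis_def)

lemma bounded_linear_cz_inv: "bounded_linear cz_inv"
  unfolding linear_conv_bounded_linear[symmetric]
proof (rule linearI)
  show "cz_inv (a + b) = cz_inv a + cz_inv b" for a b
    by (cases a; cases b) (simp add: vec_eq_iff forall_8 cz_inv_nth)
  show "cz_inv (r *\<^sub>R a) = r *\<^sub>R cz_inv a" for r a
    by (cases a) (simp add: vec_eq_iff forall_8 cz_inv_nth)
qed

interpretation pos: frame z0 z2 z3 "\<lambda>x. - z1 x" cz_inv
  by (rule frame.intro)
    (simp_all add: bounded_linear_z bounded_linear_minus bounded_linear_cz_inv z_flow,
      simp_all add: z0_def z1_def z2_def z3_def cz_inv_nth complex_eq_iff vec_eq_iff forall_8)

text \<open>With \<open>w'\<close> first, f is conjugated and b changes sign, which turns negative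
  levels of b into positive ones.\<close>

interpretation neg: frame z3 "\<lambda>x. - z1 x" z0 z2 "\<lambda>a. cz_inv (fst (snd (snd a)), snd (snd (snd a)), fst a, fst (snd a))"
  by (rule frame.intro)
    (simp_all add: z_flow pos.CC' pos.C'C bounded_linear_z bounded_linear_minus
        bounded_linear_compose[OF bounded_linear_cz_inv bounded_linear_permute(2)])

lemma pos_coords: "pos.fC x = f_plus x" "pos.bC x = b_fun x"
  by (simp_all add: pos.fC_def pos.bC_def f_plus_def b_fun_def u_fun_def v_fun_def pairing_def
      quartic_def algebra_simps)

lemma neg_coords: "neg.fC x = cnj (f_plus x)" "neg.bC x = - b_fun x"
  by (simp_all add: neg.fC_def neg.bC_def f_plus_def b_fun_def u_fun_def v_fun_def pairing_def
      quartic_def algebra_simps)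

text \<open>\<open>a_fun\<close> fixes the modulus of \<open>f_plus\<close> and \<open>t_fun\<close>
  its argument. For \<open>a\<^sub>0 = 0\<close> the condition reads f = 0 at every angle, so one
  formula covers both cases.\<close>

lemma W_set_eq:
  assumes "a\<^sub>0 \<ge> 0" "0 \<le> t\<^sub>0" "t\<^sub>0 < 2 * pi"
  shows "W_set a\<^sub>0 b\<^sub>0 t\<^sub>0 =
    {proj x | x. x \<noteq> 0 \<and> f_plus x = of_real (sqrt (a\<^sub>0 / 2)) * cis t\<^sub>0 \<and> b_fun x = b\<^sub>0}"
proof (cases "a\<^sub>0 > 0")
  case True
  have "a_fun x = a\<^sub>0 \<and> t_fun x = t\<^sub>0 \<longleftrightarrow> f_plus x = of_real (sqrt (a\<^sub>0 / 2)) * cis t\<^sub>0" for x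
  proof
    assume *: "a_fun x = a\<^sub>0 \<and> t_fun x = t\<^sub>0"
    then have "(cmod (f_plus x))\<^sup>2 = a\<^sub>0 / 2"
      by (simp add: a_fun_def)
    then have "cmod (f_plus x) = sqrt (a\<^sub>0 / 2)"
      by (metis norm_ge_zero real_sqrt_unique)
    with * show "f_plus x = of_real (sqrt (a\<^sub>0 / 2)) * cis t\<^sub>0"
      using Arg2pi_eq[of "f_plus x"] by (simp add: t_fun_def cis_conv_exp)
  next
    assume *: "f_plus x = of_real (sqrt (a\<^sub>0 / 2)) * cis t\<^sub>0"
    have "t_fun x = t\<^sub>0"
      unfolding t_fun_def using * True assms
      by (intro Arg2pi_unique[of "sqrt (a\<^sub>0 / 2)"]) (auto simp: cis_conv_exp)
    moreover have "a_fun x = a\<^sub>0"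
      unfolding a_fun_def * using True by (simp add: norm_mult)
    ultimately show "a_fun x = a\<^sub>0 \<and> t_fun x = t\<^sub>0"
      by simp
  qed
  then show ?thesis
    using True unfolding W_set_def by auto
next
  case False
  then have "a\<^sub>0 = 0"
    using assms by simp
  then show ?thesis
    by (simp add: W_set_def a_fun_def)
qed

theorem theorem6p6:
  fixes a\<^sub>0 b\<^sub>0 t\<^sub>0 :: real
  assumes "a\<^sub>0 \<ge> 0" and "0 \<le> t\<^sub>0" and "t\<^sub>0 < 2 * pi" and "(a\<^sub>0, b\<^sub>0) \<noteq> (0, 0)"
  shows "coassociative (W_set a\<^sub>0 b\<^sub>0 t\<^sub>0) \<and>
         diffeomorphic (W_set a\<^sub>0 b\<^sub>0 t\<^sub>0) (W_charts (W_set a\<^sub>0 b\<^sub>0 t\<^sub>0)) TS2 TS2_charts"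
proof -
  define c where "c = of_real (sqrt (a\<^sub>0 / 2)) * cis t\<^sub>0"
  define W where "W = W_set a\<^sub>0 b\<^sub>0 t\<^sub>0"
  \<comment> \<open>The same set in both frames; the sign of \<open>b\<^sub>0\<close> decides below
    which of them has a nonnegative level.\<close>
  have W: "W = pos.level_set c b\<^sub>0" "W = neg.level_set (cnj c) (- b\<^sub>0)"
    unfolding W_def W_set_eq[OF assms(1-3)] pos.level_set_def neg.level_set_def c_def[symmetric]
      pos_coords neg_coords by simp_all
  have "varphi_vanishes_on W"
    by (rule varphi_vanishes_on_level_set[where c = c and b = b\<^sub>0])
      (auto simp: W(1) preim_def pos.proj_in_level_set pos_coords)
  moreover have "c = 0 \<longleftrightarrow> a\<^sub>0 = 0"
    using assms(1) by (simp add: c_def)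
  then have nz: "b\<^sub>0 \<noteq> 0 \<or> c \<noteq> 0"
    using assms(4) by auto
  moreover have "embedded_submanifold (cone_charts :: (_, (real^4) \<times> (real^3)) chart set) W \<and>
      diffeomorphic W (W_charts W) TS2 TS2_charts"
  proof (cases "b\<^sub>0 \<ge> 0")
    case True
    then show ?thesis
      using pos.level_set_embedded_and_diffeomorphic[of b\<^sub>0 c] nz W(1) by auto
  next
    case False
    then show ?thesis
      using neg.level_set_embedded_and_diffeomorphic[of "- b\<^sub>0" "cnj c"] W(2) by auto
  qed
  ultimately show ?thesis
    unfolding coassociative_def W_def by blast
qed

end
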